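(* A unitary weight module over the Schrödinger-Virasoro algebra $\mathfrak{sv}$ is simply a unitary weight module over the Virasoro algebra $Vir$. That is, if $V$ is a unitary weight module over $\mathfrak{sv}$, then $M.V=0$ and $Y.V=0$, where $M=\bigoplus_{n\in\mathbb{Z}}\mathbb{C}M_n$ and $Y=\bigoplus_{n\in\mathbb{Z}}\mathbb{C}Y_{\frac12+n}$.
   Context: The Schrödinger-Virasoro algebra $\mathfrak{sv}$ is the complex Lie algebra with basis $\{L_n,M_n,Y_{n+\frac12},c\mid n\in\mathbb{Z}\}$ and brackets, for $m,n\in\mathbb{Z}$, $$[L_m,L_n]=(n-m)L_{n+m}+\delta_{m+n,0}\tfrac{m^3-m}{12}c,\quad [L_m,M_n]=nM_{n+m},\quad [L_m,Y_{n+\frac12}]=\big(n+\tfrac{1-m}{2}\big)Y_{m+n+\frac12},$$ $$[Y_{m+\frac12},Y_{n+\frac12}]=(n-m)M_{m+n+1},\quad [M_m,M_n]=0=[M_m,Y_{n+\frac12}]=[\mathfrak{sv},c].$$ $Vir=\bigoplus_{n}\mathbb{C}L_n\oplus\mathbb{C}c$ is the Virasoro subalgebra, and $M\oplus Y$ is an ideal with $\mathfrak{sv}/(M\oplus Y)\simeq Vir$. Let $\mathfrak{h}=\mathrm{span}_{\mathbb{C}}\{L_0,M_0,c\}$. A weight module over $\mathfrak{sv}$ (resp. $Vir$) is a module that is the direct sum of its weight spaces with respect to $\mathfrak{h}$ (resp. $\mathbb{C}L_0\oplus\mathbb{C}c$), all weight spaces being assumed finite dimensional (i.e. a Harish-Chandra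 module). A conjugate-linear anti-involution of a complex Lie algebra $\mathfrak{g}$ is a map $\theta:\mathfrak{g}\to\mathfrak{g}$ with $\theta(x+y)=\theta(x)+\theta(y)$, $\theta(\alpha x)=\overline{\alpha}\theta(x)$, $\theta([x,y])=[\theta(y),\theta(x)]$ and $\theta^2=\mathrm{id}$ for all $x,y\in\mathfrak{g}$, $\alpha\in\mathbb{C}$. A $\mathfrak{g}$-module $V$ is unitary (for a conjugate-linear anti-involution $\theta$) if there is a positive definite Hermitian form $\langle\ ,\ \rangle$ on $V$ such that $\langle xu,v\rangle=\langle u,\theta(x)v\rangle$ for all $u,v\in V$, $x\in\mathfrak{g}$. *)

theory Defs
  imports Complex_Main "HOL-Library.Poly_Mapping" "HOL-Library.FuncSet"
begin

section \<open>The Schroedinger-Virasoro algebra\<close>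

text \<open>The constructor \<open>Y n\<close> stands for the basis vector with half-integral index \<open>n + 1/2\<close>.\<close>

datatype sv_basis = L int | M int | Y int | C

type_synonym sv = "sv_basis \<Rightarrow>\<^sub>0 complex"

definition sv_elem :: "sv_basis \<Rightarrow> sv" where
  "sv_elem b = Poly_Mapping.single b 1"

definition sv_scale :: "complex \<Rightarrow> sv \<Rightarrow> sv" where
  "sv_scale a x = Poly_Mapping.map ((*) a) x"

lemma lookup_sv_scale [simp]:
  "Poly_Mapping.lookup (sv_scale a x) b = a * Poly_Mapping.lookup x b"
  by (simp add: sv_scale_def map.rep_eq when_def)

interpretation sv: vector_space sv_scale
  by unfold_locales (auto intro!: poly_mapping_eqI simp: lookup_add algebra_simps)

fun sv_basis_bracket :: "sv_basis \<Rightarrow> sv_basis \<Rightarrow> sv" where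
  "sv_basis_bracket (L m) (L n) =
     sv_scale (of_int (n - m)) (sv_elem (L (n + m)))
     + (if m + n = 0 then sv_scale (of_int (m ^ 3 - m) / 12) (sv_elem C) else 0)"
| "sv_basis_bracket (L m) (M n) = sv_scale (of_int n) (sv_elem (M (n + m)))"
| "sv_basis_bracket (M n) (L m) = sv_scale (- of_int n) (sv_elem (M (n + m)))"
| "sv_basis_bracket (L m) (Y n) =
     sv_scale (of_int n + (1 - of_int m) / 2) (sv_elem (Y (m + n)))"
| "sv_basis_bracket (Y n) (L m) =
     sv_scale (- (of_int n + (1 - of_int m) / 2)) (sv_elem (Y (m + n)))"
| "sv_basis_bracket (Y m) (Y n) = sv_scale (of_int (n - m)) (sv_elem (M (m + n + 1)))"
| "sv_basis_bracket (M m) (M n) = 0"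
| "sv_basis_bracket (M m) (Y n) = 0"
| "sv_basis_bracket (Y n) (M m) = 0"
| "sv_basis_bracket C b = 0"
| "sv_basis_bracket b C = 0"

definition sv_bracket :: "sv \<Rightarrow> sv \<Rightarrow> sv" where
  "sv_bracket x y = (\<Sum>a\<in>Poly_Mapping.keys x. \<Sum>b\<in>Poly_Mapping.keys y.
     sv_scale (Poly_Mapping.lookup x a * Poly_Mapping.lookup y b) (sv_basis_bracket a b))"

lemma sv_bracket_elem: "sv_bracket (sv_elem a) (sv_elem b) = sv_basis_bracket a b"
  by (simp add: sv_bracket_def sv_elem_def)

definition sv_M :: "sv set" where
  "sv_M = sv.span (range (\<lambda>n. sv_elem (M n)))"

definition sv_Y :: "sv set" where
  "sv_Y = sv.span (range (\<lambda>n. sv_elem (Y n)))"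

definition sv_cartan :: "sv set" where
  "sv_cartan = sv.span {sv_elem (L 0), sv_elem (M 0), sv_elem C}"

definition Vir :: "sv set" where
  "Vir = sv.span (insert (sv_elem C) (range (\<lambda>n. sv_elem (L n))))"

definition Vir_cartan :: "sv set" where
  "Vir_cartan = sv.span {sv_elem (L 0), sv_elem C}"

section \<open>Unitary weight modules\<close>

text \<open>The notions below are relative to a Lie subalgebra \<open>g\<close> of \<open>sv\<close> with a commutative
  subalgebra \<open>h\<close>; they are used for \<open>g = UNIV\<close>, \<open>h = sv_cartan\<close> and for \<open>g = Vir\<close>,
  \<open>h = Vir_cartan\<close>. The module is the whole type \<open>'v\<close>, with complex scalar
  multiplication \<open>scale\<close> and action map \<open>act\<close>; only the values of \<open>act\<close> on \<open>g\<close> matter.\<close>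

definition lie_module ::
    "sv set \<Rightarrow> (complex \<Rightarrow> 'v::ab_group_add \<Rightarrow> 'v) \<Rightarrow> (sv \<Rightarrow> 'v \<Rightarrow> 'v) \<Rightarrow> bool" where
  "lie_module g scale act \<longleftrightarrow>
     vector_space scale \<and>
     (\<forall>x\<in>g. \<forall>u v. act x (u + v) = act x u + act x v) \<and>
     (\<forall>x\<in>g. \<forall>a v. act x (scale a v) = scale a (act x v)) \<and>
     (\<forall>x\<in>g. \<forall>y\<in>g. \<forall>v. act (x + y) v = act x v + act y v) \<and>
     (\<forall>x\<in>g. \<forall>a v. act (sv_scale a x) v = scale a (act x v)) \<and>
     (\<forall>x\<in>g. \<forall>y\<in>g. \<forall>v. act (sv_bracket x y) v = act x (act y v) - act y (act x v))"

text \<open>A linear functional on \<open>h\<close> is represented by its extension that is \<open>undefined\<close> outside \<open>h\<close>,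
  so that distinct elements of \<open>dual_space h\<close> are distinct functionals.\<close>

definition dual_space :: "sv set \<Rightarrow> (sv \<Rightarrow> complex) set" where
  "dual_space h = {wt \<in> extensional h.
     (\<forall>x\<in>h. \<forall>y\<in>h. wt (x + y) = wt x + wt y) \<and> (\<forall>x\<in>h. \<forall>a. wt (sv_scale a x) = a * wt x)}"

definition weight_space ::
    "sv set \<Rightarrow> (complex \<Rightarrow> 'v \<Rightarrow> 'v) \<Rightarrow> (sv \<Rightarrow> 'v \<Rightarrow> 'v) \<Rightarrow> (sv \<Rightarrow> complex) \<Rightarrow> 'v set" where
  "weight_space h scale act wt = {v. \<forall>x\<in>h. act x v = scale (wt x) v}"

definition weight_module ::
    "sv set \<Rightarrow> sv set \<Rightarrow> (complex \<Rightarrow> 'v::ab_group_add \<Rightarrow> 'v) \<Rightarrow> (sv \<Rightarrow> 'v \<Rightarrow> 'v) \<Rightarrow> bool" where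
  "weight_module g h scale act \<longleftrightarrow>
     lie_module g scale act \<and>
     (\<forall>v. \<exists>!f. (\<forall>wt\<in>dual_space h. f wt \<in> weight_space h scale act wt) \<and>
               (\<forall>wt. wt \<notin> dual_space h \<longrightarrow> f wt = 0) \<and>
               finite {wt. f wt \<noteq> 0} \<and> v = (\<Sum>wt | f wt \<noteq> 0. f wt)) \<and>
     (\<forall>wt\<in>dual_space h. \<exists>B. finite B \<and> weight_space h scale act wt = module.span scale B)"

definition conj_anti_involution :: "sv set \<Rightarrow> (sv \<Rightarrow> sv) \<Rightarrow> bool" where
  "conj_anti_involution g \<theta> \<longleftrightarrow>
     (\<forall>x\<in>g. \<theta> x \<in> g) \<and>
     (\<forall>x\<in>g. \<forall>y\<in>g. \<theta> (x + y) = \<theta> x + \<theta> y) \<and>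
     (\<forall>x\<in>g. \<forall>a. \<theta> (sv_scale a x) = sv_scale (cnj a) (\<theta> x)) \<and>
     (\<forall>x\<in>g. \<forall>y\<in>g. \<theta> (sv_bracket x y) = sv_bracket (\<theta> y) (\<theta> x)) \<and>
     (\<forall>x\<in>g. \<theta> (\<theta> x) = x)"

definition pos_def_hermitian_form ::
    "(complex \<Rightarrow> 'v::ab_group_add \<Rightarrow> 'v) \<Rightarrow> ('v \<Rightarrow> 'v \<Rightarrow> complex) \<Rightarrow> bool" where
  "pos_def_hermitian_form scale B \<longleftrightarrow>
     (\<forall>u v w. B (u + v) w = B u w + B v w) \<and>
     (\<forall>a u v. B (scale a u) v = a * B u v) \<and>
     (\<forall>u v. B v u = cnj (B u v)) \<and>
     (\<forall>v. v \<noteq> 0 \<longrightarrow> Re (B v v) > 0)"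

definition unitary_module ::
    "sv set \<Rightarrow> (sv \<Rightarrow> sv) \<Rightarrow> (complex \<Rightarrow> 'v::ab_group_add \<Rightarrow> 'v) \<Rightarrow> (sv \<Rightarrow> 'v \<Rightarrow> 'v) \<Rightarrow> bool" where
  "unitary_module g \<theta> scale act \<longleftrightarrow>
     lie_module g scale act \<and>
     (\<exists>B. pos_def_hermitian_form scale B \<and>
          (\<forall>x\<in>g. \<forall>u v. B (act x u) v = B u (act (\<theta> x) v)))"

definition unitary_weight_module ::
    "sv set \<Rightarrow> sv set \<Rightarrow> (complex \<Rightarrow> 'v::ab_group_add \<Rightarrow> 'v) \<Rightarrow> (sv \<Rightarrow> 'v \<Rightarrow> 'v) \<Rightarrow> bool" where
  "unitary_weight_module g h scale act \<longleftrightarrow>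
     weight_module g h scale act \<and>
     (\<exists>\<theta>. conj_anti_involution g \<theta> \<and> unitary_module g \<theta> scale act)"

end

theory Submission
  imports Defs "HOL-Computational_Algebra.Fundamental_Theorem_Algebra"
begin

text \<open>Every conjugate-linear anti-involution \<open>\<theta>\<close> preserves the ideal \<open>J\<close> spanned by the \<open>M\<close> and
  \<open>Y\<close> vectors, because \<open>\<theta> J\<close> is a nilpotent ideal, and it preserves \<open>M = [J, J]\<close>. Hence the
  operators by which \<open>M\<close> acts, and those by which \<open>J\<close> acts once \<open>M\<close> acts by zero, generate a
  commutative algebra closed under adjoints. Such an algebra consists of normal operators, so if
  \<open>R\<close> is in it, \<open>p(R) v = 0\<close> with \<open>p \<noteq> 0\<close>, and \<open>S = [D, R]\<close> is in it as well, then \<open>S v = 0\<close>.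
  On finite-dimensional weight spaces every operator of degree zero satisfies such a polynomial.
  A Heisenberg argument first shows that \<open>M 0\<close> acts by zero; then \<open>D = L 1\<close> with
  \<open>R = M 1 M (-1)\<close> gives \<open>M = 0\<close>, and \<open>R = Y 0 Y (-1)\<close> gives \<open>Y = 0\<close>. Finally \<open>\<theta>\<close> followed by the
  projection along \<open>J\<close> is the anti-involution of the Virasoro algebra.\<close>

section \<open>Polynomials in a linear operator\<close>

locale lin_endo = Vector_Spaces.linear scale scale R
  for scale :: "'k::field \<Rightarrow> 'v::ab_group_add \<Rightarrow> 'v" and R :: "'v \<Rightarrow> 'v"
begin

text \<open>The Horner scheme for \<open>p(R) v\<close>: each coefficient multiplies the fixed
  vector \<open>v\<close>, and \<open>R\<close> acts on the accumulated vector.\<close>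

definition poly_op :: "'k poly \<Rightarrow> 'v \<Rightarrow> 'v" where
  "poly_op p v = fold_coeffs (\<lambda>a w. scale a v + R w) p 0"

lemma poly_op_0 [simp]: "poly_op 0 v = 0"
  by (simp add: poly_op_def)

lemma poly_op_pCons [simp]: "poly_op (pCons a p) v = scale a v + R (poly_op p v)"
  by (cases "p = 0 \<and> a = 0") (auto simp: poly_op_def zero)

lemma poly_op_add: "poly_op (p + q) v = poly_op p v + poly_op q v"
  by (induction p q rule: poly_induct2) (simp_all add: add vs1.scale_left_distrib algebra_simps)

lemma poly_op_smult: "poly_op (smult c p) v = scale c (poly_op p v)"
  by (induction p) (simp_all add: scale vs1.scale_right_distrib)

lemma poly_op_mult: "poly_op (p * q) v = poly_op p (poly_op q v)"
  by (induction p) (simp_all add: poly_op_add poly_op_smult)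

lemma poly_op_zero_right [simp]: "poly_op p 0 = 0"
  by (induction p) (simp_all add: zero)

lemma poly_op_add_right: "poly_op p (u + v) = poly_op p u + poly_op p v"
  by (induction p) (simp_all add: add vs1.scale_right_distrib algebra_simps)

lemma poly_op_scale_right: "poly_op p (scale c v) = scale c (poly_op p v)"
  by (induction p) (simp_all add: scale vs1.scale_right_distrib mult.commute)

lemma poly_op_monom: "poly_op (monom c i) v = scale c ((R ^^ i) v)"
  by (induction i) (simp_all add: monom_0 monom_Suc zero scale)

lemma poly_op_sum: "poly_op (\<Sum>i\<in>I. p i) v = (\<Sum>i\<in>I. poly_op (p i) v)"
  by (induction I rule: infinite_finite_induct) (simp_all add: poly_op_add)

lemma poly_op_in_span:
  assumes "\<And>w. w \<in> vs1.span B \<Longrightarrow> R w \<in> vs1.span B" "v \<in> vs1.span B"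
  shows "poly_op p v \<in> vs1.span B"
  using assms
  by (induction p) (simp_all add: vs1.span_add vs1.span_scale vs1.span_zero)

text \<open>Here \<open>S\<close> is the commutator \<open>[D, R]\<close>. Because it commutes with
  \<open>R\<close>, the Leibniz rule for \<open>[D, R^i]\<close> collapses to
  \<open>i R^(i-1) S\<close>, hence \<open>[D, p(R)] = p'(R) S\<close>.\<close>

lemma poly_op_derivation:
  assumes D: "Vector_Spaces.linear scale scale D"
    and DR: "\<And>v. D (R v) = R (D v) + S v"
    and S: "Vector_Spaces.linear scale scale S"
    and SR: "\<And>v. S (R v) = R (S v)"
  shows "D (poly_op p v) = poly_op p (D v) + poly_op (pderiv p) (S v)"
proof -
  interpret D: Vector_Spaces.linear scale scale D by (fact D)
  interpret S: Vector_Spaces.linear scale scale S by (fact S)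
  have comm: "S (poly_op p v) = poly_op p (S v)" for p v
    by (induction p) (simp_all add: S.zero S.add S.scale SR)
  show ?thesis
    by (induction p)
      (simp_all add: D.zero D.add D.scale DR comm pderiv_pCons poly_op_add add algebra_simps)
qed

lemma ex_annihilating_poly:
  assumes "finite B" and "\<And>w. w \<in> vs1.span B \<Longrightarrow> R w \<in> vs1.span B"
    and "v \<in> vs1.span B"
  shows "\<exists>p. p \<noteq> 0 \<and> poly_op p v = 0"
proof -
  define f where "f i = (R ^^ i) v" for i
  have f_span: "f i \<in> vs1.span B" for i
    unfolding f_def by (induction i) (simp_all add: assms)
  show ?thesis
  \<comment> \<open>Linear dependence is a property of sets, so it yields coefficients only if the
    \<open>card B + 1\<close> iterates are distinct. If two of them agree, \<open>X^i - X^j\<close>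
    annihilates \<open>v\<close> instead.\<close>
  proof (cases "inj_on f {..card B}")
    case True
    have "card (f ` {..card B}) > card B"
      using True by (simp add: card_image)
    hence "vs1.dependent (f ` {..card B})"
      using vs1.independent_span_bound[OF assms(1), of "f ` {..card B}"] f_span by fastforce
    then obtain u where u: "\<exists>w\<in>f ` {..card B}. u w \<noteq> 0"
        "(\<Sum>w\<in>f ` {..card B}. scale (u w) w) = 0"
      by (subst (asm) vs1.dependent_finite) auto
    define p where "p = (\<Sum>i\<le>card B. monom (u (f i)) i)"
    have "poly_op p v = (\<Sum>i\<le>card B. scale (u (f i)) (f i))"
      by (simp add: p_def poly_op_sum poly_op_monom f_def)
    also have "\<dots> = 0"
      using u(2) sum.reindex[OF True, of "\<lambda>w. scale (u w) w"] by simp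
    finally have "poly_op p v = 0" .
    obtain i where "i \<le> card B" "u (f i) \<noteq> 0" using u(1) by auto
    hence "coeff p i \<noteq> 0" by (simp add: p_def coeff_sum)
    hence "p \<noteq> 0" by auto
    thus ?thesis using \<open>poly_op p v = 0\<close> by blast
  next
    case False
    then obtain i j where ij: "i \<noteq> j" "f i = f j" by (auto simp: inj_on_def)
    define p where "p = monom (1 :: 'k) i + monom (- 1) j"
    have "poly_op p v = 0"
      using ij(2) by (simp add: p_def poly_op_add poly_op_monom f_def)
    moreover have "coeff p i \<noteq> 0" using ij(1) by (simp add: p_def)
    hence "p \<noteq> 0" by auto
    ultimately show ?thesis by blast
  qed
qed

text \<open>Polynomials in \<open>R\<close> commute, so the product of annihilators of the finitely
  many generators annihilates each generator, hence the whole span.\<close>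

lemma ex_annihilating_poly_span:
  assumes "finite B" and "\<And>w. w \<in> vs1.span B \<Longrightarrow> R w \<in> vs1.span B"
  shows "\<exists>p. p \<noteq> 0 \<and> (\<forall>v\<in>vs1.span B. poly_op p v = 0)"
proof -
  have "\<exists>p. p \<noteq> 0 \<and> (\<forall>v\<in>F. poly_op p v = 0)" if "finite F" "F \<subseteq> vs1.span B" for F
    using that
  proof (induction F)
    case empty
    show ?case by (intro exI[of _ 1]) auto
  next
    case (insert b F)
    then obtain p where p: "p \<noteq> 0" "\<forall>v\<in>F. poly_op p v = 0" by auto
    obtain q where q: "q \<noteq> 0" "poly_op q b = 0"
      using ex_annihilating_poly[of B b] assms insert.prems by auto
    have "poly_op (q * p) b = 0"
      using q(2) by (subst mult.commute) (simp add: poly_op_mult)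
    thus ?case using p q(1) by (intro exI[of _ "q * p"]) (auto simp: poly_op_mult)
  qed
  from this[of B] obtain p where p: "p \<noteq> 0" "\<forall>v\<in>B. poly_op p v = 0"
    using assms(1) vs1.span_superset by auto
  have "poly_op p v = 0" if "v \<in> vs1.span B" for v
    using that p(2)
    by (induction rule: vs1.span_induct_alt) (auto simp: poly_op_add_right poly_op_scale_right)
  thus ?thesis using p(1) by auto
qed

lemma poly_op_eigenvector: "R w = scale h w \<Longrightarrow> poly_op p w = scale (poly p h) w"
  by (induction p) (simp_all add: scale vs1.scale_left_distrib mult.commute)

lemma finite_eigenvalues:
  assumes "finite B" and "\<And>w. w \<in> vs1.span B \<Longrightarrow> R w \<in> vs1.span B"
  shows "finite {h. \<exists>w\<in>vs1.span B. w \<noteq> 0 \<and> R w = scale h w}"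
proof -
  obtain p where p: "p \<noteq> 0" "\<forall>v\<in>vs1.span B. poly_op p v = 0"
    using ex_annihilating_poly_span[OF assms] by auto
  have "poly p h = 0" if "w \<in> vs1.span B" "w \<noteq> 0" "R w = scale h w" for h w
    using p(2) poly_op_eigenvector[OF that(3), of p] that by auto
  hence "{h. \<exists>w\<in>vs1.span B. w \<noteq> 0 \<and> R w = scale h w} \<subseteq> {h. poly p h = 0}" by auto
  thus ?thesis using poly_roots_finite[OF p(1)] finite_subset by blast
qed

text \<open>Split a linear factor off an annihilator of \<open>v\<close>: if
  \<open>(R - a) q(R) v = 0\<close>, either \<open>q(R) v\<close> is an eigenvector or
  \<open>q\<close> is an annihilator of smaller degree. The hypothesis \<open>root\<close> expresses
  algebraic closedness.\<close>

lemma ex_eigenvector: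
  assumes root: "\<And>p :: 'k poly. degree p > 0 \<Longrightarrow> \<exists>a. poly p a = 0"
    and B: "finite B" "\<And>w. w \<in> vs1.span B \<Longrightarrow> R w \<in> vs1.span B"
    and v: "v \<in> vs1.span B" "v \<noteq> 0"
  shows "\<exists>h. \<exists>w\<in>vs1.span B. w \<noteq> 0 \<and> R w = scale h w"
proof -
  have "\<exists>h. \<exists>w\<in>vs1.span B. w \<noteq> 0 \<and> R w = scale h w"
    if "p \<noteq> 0" "poly_op p v = 0" for p
    using that
  proof (induction "degree p" arbitrary: p rule: less_induct)
    case less
    show ?case
    proof (cases "degree p = 0")
      case True
      then obtain c where "p = [:c:]" using degree_eq_zeroE by blast
      thus ?thesis using less.prems v(2) by (simp add: zero)
    next
      case False
      then obtain a where "poly p a = 0" using root[of p] by auto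
      then obtain q where q: "p = [:- a, 1:] * q"
        unfolding poly_eq_0_iff_dvd by blast
      have "q \<noteq> 0" using q less.prems by auto
      hence deg: "degree q < degree p" by (simp only: q) (subst degree_mult_eq, auto)
      have "poly_op p v = scale (- a) (poly_op q v) + R (poly_op q v)"
        by (simp only: q poly_op_mult poly_op_pCons poly_op_0 vs1.scale_one zero add_0_right)
      hence "R (poly_op q v) = scale a (poly_op q v)"
        using less.prems(2) by simp
      thus ?thesis
        using less.hyps[OF deg \<open>q \<noteq> 0\<close>] poly_op_in_span[OF B(2) v(1), of q] by auto
    qed
  qed
  thus ?thesis using ex_annihilating_poly[OF B v(1)] by blast
qed

end

section \<open>Commuting operators closed under adjoints\<close>

text \<open>The unital algebra generated by \<open>G\<close>. Over a vector space,
  \<open>smul\<close> supplies the identity and the zero map, so polynomials in a member are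
  members.\<close>

inductive_set op_alg :: "(complex \<Rightarrow> 'v::ab_group_add \<Rightarrow> 'v) \<Rightarrow> ('v \<Rightarrow> 'v) set \<Rightarrow> ('v \<Rightarrow> 'v) set"
  for scale G where
  gen: "f \<in> G \<Longrightarrow> f \<in> op_alg scale G"
| smul: "(\<lambda>v. scale a v) \<in> op_alg scale G"
| plus: "f \<in> op_alg scale G \<Longrightarrow> g \<in> op_alg scale G \<Longrightarrow> (\<lambda>v. f v + g v) \<in> op_alg scale G"
| comp: "f \<in> op_alg scale G \<Longrightarrow> g \<in> op_alg scale G \<Longrightarrow> (\<lambda>v. f (g v)) \<in> op_alg scale G"

text \<open>Adjoints need not exist in infinite dimension, so they are required for the generators.
  The adjoint of a generator is itself a generator and therefore commutes with it.\<close>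

locale star_ops = vector_space scale
  for scale :: "complex \<Rightarrow> 'v::ab_group_add \<Rightarrow> 'v" +
  fixes B :: "'v \<Rightarrow> 'v \<Rightarrow> complex" and G :: "('v \<Rightarrow> 'v) set"
  assumes form: "pos_def_hermitian_form scale B"
    and gen_linear: "f \<in> G \<Longrightarrow> Vector_Spaces.linear scale scale f"
    and gen_commute: "f \<in> G \<Longrightarrow> g \<in> G \<Longrightarrow> f (g v) = g (f v)"
    and gen_adjoint: "f \<in> G \<Longrightarrow> \<exists>g\<in>G. \<forall>u v. B (f u) v = B u (g v)"
begin

lemma form_simps:
  "B (u + v) w = B u w + B v w" "B (scale a u) v = a * B u v"
  "B w (u + v) = B w u + B w v" "B u (scale a v) = cnj a * B u v"
  using form unfolding pos_def_hermitian_form_def by (metis complex_cnj_add complex_cnj_mult)+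

lemma form_zero: "B 0 v = 0" "B v 0 = 0"
  using form_simps(1)[of 0 0 v] form_simps(3)[of v 0 0] by simp_all

lemma form_self_eq_0:
  assumes "B v v = 0"
  shows "v = 0"
proof (rule ccontr)
  assume "v \<noteq> 0"
  hence "Re (B v v) > 0" using form unfolding pos_def_hermitian_form_def by blast
  thus False using assms by simp
qed

lemma linearI:
  assumes "\<And>u v. f (u + v) = f u + f v" "\<And>a v. f (scale a v) = scale a (f v)"
  shows "Vector_Spaces.linear scale scale f"
  using assms vector_space_axioms by (simp add: Vector_Spaces.linear_iff)

lemma op_linear:
  assumes "f \<in> op_alg scale G"
  shows "Vector_Spaces.linear scale scale f"
  using assms
proof induction
  case (smul a)
  show ?case
    by (rule linearI) (simp_all add: scale_right_distrib mult.commute)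
next
  case (plus f g)
  interpret f: Vector_Spaces.linear scale scale f by (fact plus.IH)
  interpret g: Vector_Spaces.linear scale scale g by (fact plus.IH)
  show ?case
    by (rule linearI) (simp_all add: f.add g.add f.scale g.scale scale_right_distrib algebra_simps)
next
  case (comp f g)
  interpret f: Vector_Spaces.linear scale scale f by (fact comp.IH)
  interpret g: Vector_Spaces.linear scale scale g by (fact comp.IH)
  show ?case by (rule linearI) (simp_all add: f.add g.add f.scale g.scale)
qed (fact gen_linear)

lemma op_commute_gen:
  assumes "f \<in> op_alg scale G" "g \<in> G"
  shows "f (g v) = g (f v)"
proof -
  interpret g: Vector_Spaces.linear scale scale g by (rule gen_linear) fact
  show ?thesis using assms
    by (induction arbitrary: v) (simp_all add: gen_commute g.scale g.add)
qed

lemma op_commute: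
  assumes "f \<in> op_alg scale G" "g \<in> op_alg scale G"
  shows "f (g v) = g (f v)"
proof -
  interpret f: Vector_Spaces.linear scale scale f by (rule op_linear) fact
  show ?thesis using assms(2,1)
    by (induction arbitrary: v) (simp_all add: op_commute_gen f.scale f.add)
qed

lemma op_adjoint:
  assumes "f \<in> op_alg scale G"
  shows "\<exists>g\<in>op_alg scale G. \<forall>u v. B (f u) v = B u (g v)"
  using assms
proof induction
  case (gen f)
  thus ?case using gen_adjoint op_alg.gen by blast
next
  case (smul a)
  show ?case
    by (rule bexI[of _ "\<lambda>v. scale (cnj a) v"]) (simp_all add: form_simps op_alg.smul)
next
  case (plus f g)
  then obtain f' g' where "f' \<in> op_alg scale G" "g' \<in> op_alg scale G"
    "\<And>u v. B (f u) v = B u (f' v)" "\<And>u v. B (g u) v = B u (g' v)" by blast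
  thus ?case
    by (intro bexI[of _ "\<lambda>v. f' v + g' v"]) (simp_all add: form_simps op_alg.plus)
next
  case (comp f g)
  then obtain f' g' where "f' \<in> op_alg scale G" "g' \<in> op_alg scale G"
    "\<And>u v. B (f u) v = B u (f' v)" "\<And>u v. B (g u) v = B u (g' v)" by blast
  thus ?case
    by (intro bexI[of _ "\<lambda>v. g' (f' v)"]) (simp_all add: op_alg.comp)
qed

text \<open>The members of the algebra are normal operators, which have no nontrivial nilpotent part.\<close>

lemma op_square_eq_0:
  assumes f: "f \<in> op_alg scale G" and "f (f v) = 0"
  shows "f v = 0"
proof -
  obtain g where g: "g \<in> op_alg scale G" "\<And>u v. B (f u) v = B u (g v)"
    using op_adjoint[OF f] by blast
  interpret g: Vector_Spaces.linear scale scale g by (rule op_linear) fact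
  \<comment> \<open>With \<open>g\<close> the adjoint of \<open>f\<close>, commutation turns
    \<open>f (g (f v))\<close> into \<open>g (f (f v)) = 0\<close>. So \<open>g (f v)\<close> has
    norm zero, and then so does \<open>f v\<close>.\<close>
  have "B (g (f v)) (g (f v)) = B (f (g (f v))) (f v)" by (simp add: g(2))
  also have "f (g (f v)) = 0"
    using op_commute[OF f g(1), of "f v"] assms(2) by (simp add: g.zero)
  finally have "g (f v) = 0" by (simp add: form_zero form_self_eq_0)
  hence "B (f v) (f v) = 0" by (simp add: g(2) form_zero)
  thus ?thesis by (rule form_self_eq_0)
qed

lemma op_power_eq_0:
  assumes f: "f \<in> op_alg scale G" and "(f ^^ Suc n) v = 0"
  shows "f v = 0"
  using assms(2)
proof (induction n)
  case (Suc n)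
  thus ?case using op_square_eq_0[OF f, of "(f ^^ n) v"] by simp
qed simp

text \<open>On the kernel of \<open>A\<close> the relation reads \<open>A (D v) = - S v\<close>.
  Applying \<open>A\<close> again gives \<open>- S (A v) = 0\<close>, and normality of
  \<open>A\<close> already forces \<open>A (D v) = 0\<close>. The operator \<open>D\<close> may lie
  outside the algebra.\<close>

lemma derivation_kernel:
  assumes D: "D 0 = 0"
    and A: "A \<in> op_alg scale G" and S: "S \<in> op_alg scale G"
    and comm: "\<And>v. D (A v) = A (D v) + S v"
    and "A v = 0"
  shows "S v = 0"
proof -
  interpret A: Vector_Spaces.linear scale scale A by (rule op_linear) fact
  interpret S: Vector_Spaces.linear scale scale S by (rule op_linear) fact
  have eq: "A (D v) = - S v" using comm[of v] assms(5) D by (simp add: eq_neg_iff_add_eq_0)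
  hence "A (A (D v)) = 0"
    using op_commute[OF A S, of v] assms(5) by (simp add: A.neg S.zero)
  hence "A (D v) = 0" by (rule op_square_eq_0[OF A])
  thus ?thesis using eq by simp
qed

text \<open>Commuting \<open>D\<close> past \<open>p(R) v = 0\<close> gives \<open>p'(R) (S v) = 0\<close> since \<open>p(R)\<close> is normal; iterating,
  a power of the normal operator \<open>S\<close> kills \<open>v\<close>.\<close>

lemma derivation_eq_0:
  assumes D: "Vector_Spaces.linear scale scale D"
    and R: "R \<in> op_alg scale G" and S: "S \<in> op_alg scale G"
    and comm: "\<And>v. D (R v) = R (D v) + S v"
    and "p \<noteq> 0" "lin_endo.poly_op scale R p v = 0"
  shows "S v = 0"
proof -
  interpret D: Vector_Spaces.linear scale scale D by (fact D)
  interpret S: Vector_Spaces.linear scale scale S by (rule op_linear) fact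
  interpret R: lin_endo scale R
    unfolding lin_endo_def by (rule op_linear) fact
  have polyR: "R.poly_op p \<in> op_alg scale G" for p
  proof (induction p)
    case 0
    have "R.poly_op 0 = (\<lambda>v. scale 0 v)" by (rule ext) simp
    thus ?case by (simp only:) (rule op_alg.smul)
  next
    case (pCons a p)
    have "R.poly_op (pCons a p) = (\<lambda>v. scale a v + R (R.poly_op p v))" by (rule ext) simp
    thus ?case by (simp only:) (rule op_alg.plus[OF op_alg.smul op_alg.comp[OF R pCons.IH]])
  qed
  have step: "R.poly_op (pderiv p) (S v) = 0" if "R.poly_op p v = 0" for p v
  proof -
    have *: "D (R.poly_op p v) = R.poly_op p (D v) + R.poly_op (pderiv p) (S v)" for v
      by (rule R.poly_op_derivation[OF D comm S.linear_axioms op_commute[OF S R]])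
    show ?thesis
      using derivation_kernel[of D "R.poly_op p" "\<lambda>v. R.poly_op (pderiv p) (S v)" v]
        that * by (simp add: D.zero polyR S op_alg.comp)
  qed
  \<comment> \<open>Each round replaces \<open>p\<close> by its derivative and \<open>v\<close> by
    \<open>S v\<close>; after \<open>degree p\<close> rounds a nonzero constant annihilates the
    vector.\<close>
  have "(S ^^ n) v = 0" if "degree p = n" "p \<noteq> 0" "R.poly_op p v = 0" for n p v
    using that
  proof (induction n arbitrary: p v)
    case 0
    then obtain c where "p = [:c:]" using degree_eq_zeroE by blast
    thus ?case using 0 by (simp add: R.zero)
  next
    case (Suc n)
    have "pderiv p \<noteq> 0" using Suc.prems(1) by (simp add: pderiv_eq_0_iff)
    thus ?case
      using Suc.IH[of "pderiv p" "S v"] step[OF Suc.prems(3)] Suc.prems(1)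
      by (simp add: degree_pderiv funpow_swap1)
  qed
  from this[of p "degree p" v] have "(S ^^ degree p) v = 0" using assms(5,6) by simp
  \<comment> \<open>One further power covers \<open>degree p = 0\<close>, since
    \<open>op_power_eq_0\<close> needs a positive exponent.\<close>
  hence "(S ^^ Suc (degree p)) v = 0" by (simp add: S.zero)
  thus ?thesis by (rule op_power_eq_0[OF S])
qed

end

section \<open>Anti-involutions and the ideal spanned by the \<open>M\<close> and \<open>Y\<close> vectors\<close>

text \<open>Coordinate description of the span of a set of basis vectors (see
  \<open>span_sv_elem\<close>): membership becomes a condition on \<open>keys\<close>.\<close>

definition sv_supp :: "sv_basis set \<Rightarrow> sv set" where
  "sv_supp S = {x. Poly_Mapping.keys x \<subseteq> S}"

lemma lookup_elem [simp]: "Poly_Mapping.lookup (sv_elem a) b = (if a = b then 1 else 0)"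
  by (simp add: sv_elem_def lookup_single when_def)

lemma sv_supp_add: "x \<in> sv_supp S \<Longrightarrow> y \<in> sv_supp S \<Longrightarrow> x + y \<in> sv_supp S"
  using Poly_Mapping.keys_add[of x y] by (auto simp: sv_supp_def)

lemma sv_supp_scale: "x \<in> sv_supp S \<Longrightarrow> sv_scale a x \<in> sv_supp S"
  by (auto simp: sv_supp_def in_keys_iff)

lemma sv_supp_minus: "x \<in> sv_supp S \<Longrightarrow> - x \<in> sv_supp S"
  by (auto simp: sv_supp_def in_keys_iff)

lemma sv_supp_0 [simp]: "0 \<in> sv_supp S"
  by (simp add: sv_supp_def)

lemma sv_supp_elem [simp]: "sv_elem b \<in> sv_supp S \<longleftrightarrow> b \<in> S"
  by (simp add: sv_supp_def sv_elem_def)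

lemma sv_supp_sum: "(\<And>i. i \<in> I \<Longrightarrow> f i \<in> sv_supp S) \<Longrightarrow> (\<Sum>i\<in>I. f i) \<in> sv_supp S"
  by (induction I rule: infinite_finite_induct) (auto intro: sv_supp_add)

lemma sv_expansion: "x = (\<Sum>b\<in>Poly_Mapping.keys x. sv_scale (Poly_Mapping.lookup x b) (sv_elem b))"
  (is "_ = ?s")
proof (rule poly_mapping_eqI)
  fix b
  show "Poly_Mapping.lookup x b = Poly_Mapping.lookup ?s b"
    by (simp add: lookup_sum if_distrib sum.delta in_keys_iff cong: if_cong)
qed

lemma span_sv_elem: "sv.span (sv_elem ` S) = sv_supp S"
proof
  show "sv.span (sv_elem ` S) \<subseteq> sv_supp S"
    by (rule sv.span_minimal) (auto simp: sv.subspace_def sv_supp_add sv_supp_scale)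
  show "sv_supp S \<subseteq> sv.span (sv_elem ` S)"
  proof
    fix x assume "x \<in> sv_supp S"
    hence "(\<Sum>b\<in>Poly_Mapping.keys x. sv_scale (Poly_Mapping.lookup x b) (sv_elem b))
      \<in> sv.span (sv_elem ` S)"
      by (intro sv.span_sum sv.span_scale sv.span_base) (auto simp: sv_supp_def)
    thus "x \<in> sv.span (sv_elem ` S)"
      by (subst sv_expansion)
  qed
qed

lemma sv_M_eq: "sv_M = sv_supp (range M)"
  by (simp add: sv_M_def image_image flip: span_sv_elem)

lemma sv_Y_eq: "sv_Y = sv_supp (range Y)"
  by (simp add: sv_Y_def image_image flip: span_sv_elem)

lemma Vir_eq: "Vir = sv_supp (insert C (range L))"
  by (simp add: Vir_def image_image flip: span_sv_elem)

lemma sv_cartan_eq: "sv_cartan = sv_supp {L 0, M 0, C}"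
  by (simp add: sv_cartan_def flip: span_sv_elem)

lemma Vir_cartan_eq: "Vir_cartan = sv_supp {L 0, C}"
  by (simp add: Vir_cartan_def flip: span_sv_elem)

lemma sv_bracket_supp:
  assumes "x \<in> sv_supp S" "y \<in> sv_supp T"
    and "\<And>a b. a \<in> S \<Longrightarrow> b \<in> T \<Longrightarrow> sv_basis_bracket a b \<in> sv_supp U"
  shows "sv_bracket x y \<in> sv_supp U"
  unfolding sv_bracket_def using assms
  by (intro sv_supp_sum sv_supp_scale) (unfold sv_supp_def, blast)

lemma sv_bracket_eq_0:
  assumes "x \<in> sv_supp S" "y \<in> sv_supp T"
    and "\<And>a b. a \<in> S \<Longrightarrow> b \<in> T \<Longrightarrow> sv_basis_bracket a b = 0"
  shows "sv_bracket x y = 0"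
  using sv_bracket_supp[of x S y T "{}"] assms by (simp add: sv_supp_def)

abbreviation MY :: "sv_basis set" where
  "MY \<equiv> range M \<union> range Y"

lemma basis_bracket_MY:
  assumes "a \<in> insert C MY \<or> b \<in> insert C MY"
  shows "sv_basis_bracket a b \<in> sv_supp MY"
  using assms by (cases a; cases b) (auto intro!: sv_supp_scale sv_supp_minus)

lemma basis_bracket_Vir:
  "a \<in> insert C (range L) \<Longrightarrow> b \<in> insert C (range L) \<Longrightarrow>
    sv_basis_bracket a b \<in> sv_supp (insert C (range L))"
  by (auto intro!: sv_supp_scale sv_supp_add)

text \<open>More than the ideal property: \<open>C\<close> is allowed in the argument but absent
  from the result, because it is central. This later removes a possible central part of
  \<open>\<theta> x\<close>.\<close>

lemma bracket_MY:
  assumes "x \<in> sv_supp (insert C MY) \<or> y \<in> sv_supp (insert C MY)"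
  shows "sv_bracket x y \<in> sv_supp MY"
  using assms
proof
  assume "x \<in> sv_supp (insert C MY)"
  thus ?thesis
    by (rule sv_bracket_supp[where T = UNIV]) (auto intro: basis_bracket_MY simp: sv_supp_def[of UNIV])
next
  assume "y \<in> sv_supp (insert C MY)"
  thus ?thesis
    by (rule sv_bracket_supp[where S = UNIV, rotated]) (auto intro: basis_bracket_MY simp: sv_supp_def[of UNIV])
qed

text \<open>Together with \<open>bracket_M_MY\<close> this makes all double brackets in the ideal
  vanish, a property that an anti-involution transports.\<close>

lemma bracket_MY_MY:
  "x \<in> sv_supp MY \<Longrightarrow> y \<in> sv_supp MY \<Longrightarrow> sv_bracket x y \<in> sv_supp (range M)"
  by (rule sv_bracket_supp[of x MY y MY]) (auto intro!: sv_supp_scale)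

lemma bracket_M_MY:
  "x \<in> sv_supp (range M) \<Longrightarrow> y \<in> sv_supp MY \<Longrightarrow> sv_bracket x y = 0"
  by (rule sv_bracket_eq_0[of x "range M" y MY]) auto

section \<open>Leading \<open>L\<close> terms and nilpotent ideals\<close>

definition L_bound :: "int \<Rightarrow> sv \<Rightarrow> bool" where
  "L_bound s x \<longleftrightarrow> (\<forall>k>s. Poly_Mapping.lookup x (L k) = 0)"

lemma lookup_basis_bracket_L:
  "Poly_Mapping.lookup (sv_basis_bracket a b) (L k) =
    (case (a, b) of (L i, L j) \<Rightarrow> if i + j = k then of_int (j - i) else 0 | _ \<Rightarrow> 0)"
  by (cases a; cases b) (auto simp: lookup_add)

lemma lookup_bracket:
  "Poly_Mapping.lookup (sv_bracket x y) c =
    (\<Sum>a\<in>Poly_Mapping.keys x. \<Sum>b\<in>Poly_Mapping.keys y.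
      Poly_Mapping.lookup x a * Poly_Mapping.lookup y b *
      Poly_Mapping.lookup (sv_basis_bracket a b) c)"
  by (simp add: sv_bracket_def lookup_sum)

text \<open>Modulo \<open>C\<close>, \<open>M\<close> and \<open>Y\<close> the bracket is that of
  vector fields, \<open>[L s, L t] = (t - s) L (s + t)\<close>, and only the two leading terms reach
  index \<open>s + t\<close>. For \<open>s = t\<close> this coefficient vanishes, so
  \<open>L_bound\<close> asserts only an upper bound.\<close>

lemma L_bound_bracket:
  assumes x: "L_bound s x" and y: "L_bound t y"
  shows "L_bound (s + t) (sv_bracket x y)"
    and "Poly_Mapping.lookup (sv_bracket x y) (L (s + t)) =
      of_int (t - s) * Poly_Mapping.lookup x (L s) * Poly_Mapping.lookup y (L t)"
proof -
  have le: "i \<le> s" if "L i \<in> Poly_Mapping.keys x" for i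
    using x that by (force simp: L_bound_def in_keys_iff not_less)
  have le': "j \<le> t" if "L j \<in> Poly_Mapping.keys y" for j
    using y that by (force simp: L_bound_def in_keys_iff not_less)
  show "L_bound (s + t) (sv_bracket x y)"
    unfolding L_bound_def lookup_bracket
  proof (intro allI impI sum.neutral ballI)
    fix k a b assume "k > s + t" "a \<in> Poly_Mapping.keys x" "b \<in> Poly_Mapping.keys y"
    thus "Poly_Mapping.lookup x a * Poly_Mapping.lookup y b *
      Poly_Mapping.lookup (sv_basis_bracket a b) (L k) = 0"
      using le le' by (fastforce simp: lookup_basis_bracket_L simp del: sv_basis_bracket.simps split: sv_basis.splits)
  qed
  have "Poly_Mapping.lookup (sv_bracket x y) (L (s + t)) =
    (\<Sum>a\<in>Poly_Mapping.keys x. \<Sum>b\<in>Poly_Mapping.keys y. if a = L s then if b = L t then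
      of_int (t - s) * Poly_Mapping.lookup x a * Poly_Mapping.lookup y b else 0 else 0)"
    unfolding lookup_bracket
  proof (intro sum.cong refl)
    fix a b assume ab: "a \<in> Poly_Mapping.keys x" "b \<in> Poly_Mapping.keys y"
    show "Poly_Mapping.lookup x a * Poly_Mapping.lookup y b *
        Poly_Mapping.lookup (sv_basis_bracket a b) (L (s + t)) =
      (if a = L s then if b = L t then
        of_int (t - s) * Poly_Mapping.lookup x a * Poly_Mapping.lookup y b else 0 else 0)"
      using ab le[of "case a of L i \<Rightarrow> i | _ \<Rightarrow> 0"] le'[of "case b of L i \<Rightarrow> i | _ \<Rightarrow> 0"]
      by (cases a; cases b) (auto simp: lookup_basis_bracket_L simp del: sv_basis_bracket.simps)
  qed
  also have "\<dots> = (\<Sum>a\<in>Poly_Mapping.keys x. if a = L s then \<Sum>b\<in>Poly_Mapping.keys y.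
      if b = L t then of_int (t - s) * Poly_Mapping.lookup x a * Poly_Mapping.lookup y b else 0
      else 0)"
    by (intro sum.cong) auto
  also have "\<dots> = of_int (t - s) * Poly_Mapping.lookup x (L s) * Poly_Mapping.lookup y (L t)"
    by (simp add: sum.delta in_keys_iff)
  finally show "Poly_Mapping.lookup (sv_bracket x y) (L (s + t)) =
      of_int (t - s) * Poly_Mapping.lookup x (L s) * Poly_Mapping.lookup y (L t)" .
qed

lemma ex_leading_L:
  assumes "Poly_Mapping.lookup x (L k) \<noteq> 0"
  obtains s where "L_bound s x" "Poly_Mapping.lookup x (L s) \<noteq> 0"
proof -
  define K where "K = {k. L k \<in> Poly_Mapping.keys x}"
  have "finite K"
    unfolding K_def using finite_vimageI[of "Poly_Mapping.keys x" L]
    by (simp add: vimage_def inj_def)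
  moreover have "k \<in> K" using assms by (simp add: K_def in_keys_iff)
  ultimately have "Max K \<in> K" "\<And>j. j \<in> K \<Longrightarrow> j \<le> Max K" by (auto intro: Max_in)
  hence "L_bound (Max K) x" "Poly_Mapping.lookup x (L (Max K)) \<noteq> 0"
    by (force simp: L_bound_def K_def in_keys_iff)+
  thus ?thesis by (rule that)
qed

lemma L_bound_elem: "L_bound m (sv_elem (L m))"
  by (simp add: L_bound_def)

text \<open>An element \<open>i\<close> with leading vector field \<open>L s\<close> would have
  \<open>[i, [i, [L m, i]]]\<close> with leading coefficient proportional to \<open>(s - m) m (m + s)\<close>.\<close>

lemma nilpotent_ideal_in_MY_C:
  assumes ideal: "\<And>x y. y \<in> I \<Longrightarrow> sv_bracket x y \<in> I"
    and nil: "\<And>x y z. x \<in> I \<Longrightarrow> y \<in> I \<Longrightarrow> z \<in> I \<Longrightarrow> sv_bracket x (sv_bracket y z) = 0"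
    and "i \<in> I"
  shows "i \<in> sv_supp (insert C MY)"
proof -
  have "Poly_Mapping.lookup i (L k) = 0" for k
  proof (rule ccontr)
    assume "Poly_Mapping.lookup i (L k) \<noteq> 0"
    then obtain s where s: "L_bound s i" "Poly_Mapping.lookup i (L s) \<noteq> 0"
      by (rule ex_leading_L)
    \<comment> \<open>This \<open>m\<close> exceeds both \<open>s\<close> and \<open>- s\<close> and
      is positive, so none of \<open>s - m\<close>, \<open>m\<close>, \<open>m + s\<close>
      vanishes.\<close>
    define m where "m = \<bar>s\<bar> + 1"
    define j where "j = sv_bracket (sv_elem (L m)) i"
    note 1 = L_bound_bracket[OF L_bound_elem[of m] s(1), folded j_def]
    note 2 = L_bound_bracket[OF s(1) 1(1)]
    note 3 = L_bound_bracket[OF s(1) 2(1)]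
    have "sv_bracket i (sv_bracket i j) = 0"
      using nil assms(3) ideal by (simp add: j_def)
    hence "of_int (s + (m + s) - s) * (of_int (m + s - s) * of_int (s - m)) = (0 :: complex)"
      using 1(2) 2(2) 3(2) s(2) by simp
    hence "s + (m + s) - s = 0 \<or> m + s - s = 0 \<or> s - m = 0"
      by (simp only: mult_eq_0_iff of_int_eq_0_iff)
    thus False by (auto simp: m_def)
  qed
  hence "L k \<notin> Poly_Mapping.keys i" for k by (simp add: in_keys_iff)
  thus ?thesis unfolding sv_supp_def
    by (auto, case_tac x) auto
qed

text \<open>Thus the span of the \<open>M\<close> vectors is the derived algebra of the ideal, and a
  bracket-reversing map that preserves the ideal preserves it too.\<close>

lemma M_eq_bracket: "\<exists>p q c. sv_elem (M n) = sv_scale c (sv_bracket (sv_elem (Y p)) (sv_elem (Y q)))"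
proof -
  \<comment> \<open>The coefficient of \<open>[Y p, Y q]\<close> is \<open>q - p\<close>, so
    distinct indices are needed: \<open>p = n\<close>, \<open>q = -1\<close> works unless
    \<open>n = -1\<close>, where \<open>p = 0\<close>, \<open>q = -2\<close> does.\<close>
  have "n + - 1 + 1 = n \<and> - 1 - n \<noteq> 0 \<or> 0 + - 2 + 1 = n \<and> - 2 - 0 \<noteq> (0 :: int)" by linarith
  then obtain p q where pq: "p + q + 1 = n" "q - p \<noteq> (0 :: int)" by metis
  have "sv_bracket (sv_elem (Y p)) (sv_elem (Y q)) = sv_scale (of_int (q - p)) (sv_elem (M n))"
    using pq(1) by (simp only: sv_bracket_elem sv_basis_bracket.simps)
  moreover have "(of_int (q - p) :: complex) \<noteq> 0" using pq(2) by (simp only: of_int_eq_0_iff not_False_eq_True)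
  ultimately have "sv_elem (M n) =
      sv_scale (inverse (of_int (q - p))) (sv_bracket (sv_elem (Y p)) (sv_elem (Y q)))"
    by (simp only: sv.scale_scale left_inverse sv.scale_one not_False_eq_True)
  thus ?thesis by blast
qed

lemma M_Y_eq_bracket:
  assumes "b \<in> MY"
  shows "\<exists>a\<in>MY. \<exists>x c. sv_elem b = sv_scale c (sv_bracket x (sv_elem a))"
proof -
  obtain a m c where a: "a \<in> MY" "c \<noteq> 0"
    "sv_bracket (sv_elem (L m)) (sv_elem a) = sv_scale c (sv_elem b)"
  proof (cases b)
    case (M n)
    \<comment> \<open>Starting from \<open>M 1\<close> gives coefficient 1 for every
      \<open>n\<close>.\<close>
    have "sv_bracket (sv_elem (L (n - 1))) (sv_elem (M 1)) = sv_scale 1 (sv_elem b)"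
      by (simp add: sv_bracket_elem M)
    thus ?thesis using that[of "M 1" 1 "n - 1"] by simp
  next
    case (Y n)
    \<comment> \<open>The bracket with \<open>L 0\<close> multiplies \<open>Y n\<close> by its
      half-integral index \<open>n + 1/2\<close>, which is never zero.\<close>
    have "of_int (2 * n + 1) \<noteq> (0 :: complex)" unfolding of_int_eq_0_iff by presburger
    hence "of_int n + (1 - of_int 0) / 2 \<noteq> (0 :: complex)" by (auto simp: field_simps)
    moreover have "sv_bracket (sv_elem (L 0)) (sv_elem (Y n)) =
        sv_scale (of_int n + (1 - of_int 0) / 2) (sv_elem b)"
      unfolding sv_bracket_elem sv_basis_bracket.simps Y add_0_left ..
    ultimately show ?thesis using that[of "Y n"] by blast
  qed (use assms in auto)
  hence "sv_elem b = sv_scale (inverse c) (sv_bracket (sv_elem (L m)) (sv_elem a))"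
    by (simp only: sv.scale_scale left_inverse sv.scale_one not_False_eq_True)
  thus ?thesis using a(1) by blast
qed

section \<open>Anti-involutions preserve the ideal\<close>

locale anti_involution =
  fixes \<theta> :: "sv \<Rightarrow> sv"
  assumes conj_anti_involution: "conj_anti_involution UNIV \<theta>"
begin

lemma theta_simps [simp]:
  "\<theta> (x + y) = \<theta> x + \<theta> y" "\<theta> (sv_scale a x) = sv_scale (cnj a) (\<theta> x)"
  "\<theta> (sv_bracket x y) = sv_bracket (\<theta> y) (\<theta> x)" "\<theta> (\<theta> x) = x"
  using conj_anti_involution by (simp_all add: conj_anti_involution_def)

lemma theta_0 [simp]: "\<theta> 0 = 0"
  using theta_simps(1)[of 0 0] by simp

lemma theta_sum: "\<theta> (\<Sum>i\<in>I. f i) = (\<Sum>i\<in>I. \<theta> (f i))"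
  by (induction I rule: infinite_finite_induct) simp_all

lemma theta_supp:
  assumes "\<And>b. b \<in> S \<Longrightarrow> \<theta> (sv_elem b) \<in> sv_supp T" and x: "x \<in> sv_supp S"
  shows "\<theta> x \<in> sv_supp T"
proof -
  have "\<theta> x = (\<Sum>b\<in>Poly_Mapping.keys x. sv_scale (cnj (Poly_Mapping.lookup x b)) (\<theta> (sv_elem b)))"
    by (subst sv_expansion) (simp add: theta_sum)
  moreover have "\<dots> \<in> sv_supp T"
    by (intro sv_supp_sum sv_supp_scale) (use assms in \<open>auto simp: sv_supp_def\<close>)
  ultimately show ?thesis by simp
qed

text \<open>Since \<open>\<theta>\<close> is onto and reverses brackets, the image of the ideal is
  again an ideal with vanishing double brackets. That criterion alone cannot exclude the central
  \<open>C\<close>.\<close>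

lemma theta_MY_C:
  assumes "x \<in> sv_supp MY"
  shows "\<theta> x \<in> sv_supp (insert C MY)"
proof (rule nilpotent_ideal_in_MY_C[of "\<theta> ` sv_supp MY"])
  fix x y assume "y \<in> \<theta> ` sv_supp MY"
  then obtain z where z: "z \<in> sv_supp MY" "y = \<theta> z" by blast
  have "sv_bracket z (\<theta> x) \<in> sv_supp MY"
    using z(1) by (intro bracket_MY disjI1) (auto simp: sv_supp_def)
  moreover have "sv_bracket x y = \<theta> (sv_bracket z (\<theta> x))" by (simp add: z(2))
  ultimately show "sv_bracket x y \<in> \<theta> ` sv_supp MY" by blast
next
  fix x y z assume "x \<in> \<theta> ` sv_supp MY" "y \<in> \<theta> ` sv_supp MY" "z \<in> \<theta> ` sv_supp MY"
  then obtain x' y' z' where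
    *: "x' \<in> sv_supp MY" "y' \<in> sv_supp MY" "z' \<in> sv_supp MY" "x = \<theta> x'" "y = \<theta> y'" "z = \<theta> z'"
    by blast
  have "sv_bracket x (sv_bracket y z) = \<theta> (sv_bracket (sv_bracket z' y') x')"
    by (simp add: *)
  also have "sv_bracket (sv_bracket z' y') x' = 0"
    using * by (intro bracket_M_MY bracket_MY_MY)
  finally show "sv_bracket x (sv_bracket y z) = 0" by simp
qed (use assms in blast)

text \<open>Basis vectors of the ideal are multiples of brackets \<open>[x, a]\<close> with
  \<open>a\<close> in the ideal; \<open>\<theta>\<close> sends these to brackets with
  \<open>\<theta> a\<close>, and bracketing discards the \<open>C\<close> part.\<close>

lemma theta_MY: "x \<in> sv_supp MY \<Longrightarrow> \<theta> x \<in> sv_supp MY"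
proof (rule theta_supp)
  fix b assume "b \<in> MY"
  then obtain a x c where a: "a \<in> MY" "sv_elem b = sv_scale c (sv_bracket x (sv_elem a))"
    using M_Y_eq_bracket by blast
  have "\<theta> (sv_elem a) \<in> sv_supp (insert C MY)" using a(1) by (intro theta_MY_C) simp
  thus "\<theta> (sv_elem b) \<in> sv_supp MY"
    by (simp add: a(2) sv_supp_scale bracket_MY)
qed

lemma theta_M: "x \<in> sv_supp (range M) \<Longrightarrow> \<theta> x \<in> sv_supp (range M)"
proof (rule theta_supp)
  fix b assume "b \<in> range M"
  then obtain p q c where
    b: "sv_elem b = sv_scale c (sv_bracket (sv_elem (Y p)) (sv_elem (Y q)))"
    using M_eq_bracket by blast
  have "\<theta> (sv_elem (Y p)) \<in> sv_supp MY" "\<theta> (sv_elem (Y q)) \<in> sv_supp MY"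
    by (auto intro!: theta_MY)
  thus "\<theta> (sv_elem b) \<in> sv_supp (range M)"
    by (simp add: b sv_supp_scale bracket_MY_MY)
qed

end

section \<open>The projection onto the Virasoro algebra along the ideal\<close>

definition Vir_proj :: "sv \<Rightarrow> sv" where
  "Vir_proj x = Poly_Mapping.Abs_poly_mapping
    (\<lambda>b. if b \<in> insert C (range L) then Poly_Mapping.lookup x b else 0)"

lemma lookup_Vir_proj [simp]:
  "Poly_Mapping.lookup (Vir_proj x) b = (if b \<in> insert C (range L) then Poly_Mapping.lookup x b else 0)"
  unfolding Vir_proj_def
  by (subst lookup_Abs_poly_mapping) (auto intro: finite_subset[OF _ finite_lookup[of x]])

lemma Vir_proj_add: "Vir_proj (x + y) = Vir_proj x + Vir_proj y"
  by (rule poly_mapping_eqI) (simp add: lookup_add)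

lemma Vir_proj_scale: "Vir_proj (sv_scale a x) = sv_scale a (Vir_proj x)"
  by (rule poly_mapping_eqI) simp

lemma Vir_proj_in_Vir: "Vir_proj x \<in> Vir"
  by (auto simp: Vir_eq sv_supp_def in_keys_iff split: if_splits)

lemma Vir_proj_id: "x \<in> Vir \<Longrightarrow> Vir_proj x = x"
  by (intro poly_mapping_eqI) (auto simp: Vir_eq sv_supp_def in_keys_iff)

lemma Vir_proj_MY: "x \<in> sv_supp MY \<Longrightarrow> Vir_proj x = 0"
  by (intro poly_mapping_eqI) (auto simp: sv_supp_def in_keys_iff)

lemma Vir_proj_diff_MY: "x - Vir_proj x \<in> sv_supp MY"
proof -
  have "b \<in> MY" if "b \<notin> insert C (range L)" for b using that by (cases b) auto
  moreover have "b \<notin> insert C (range L)" if "b \<in> Poly_Mapping.keys (x - Vir_proj x)" for b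
    using that by (auto simp: in_keys_iff lookup_minus split: if_splits)
  ultimately show ?thesis unfolding sv_supp_def by blast
qed

lemma Vir_proj_sum: "Vir_proj (\<Sum>i\<in>I. f i) = (\<Sum>i\<in>I. Vir_proj (f i))"
proof (induction I rule: infinite_finite_induct)
  case (insert i I)
  thus ?case by (simp add: Vir_proj_add)
qed (simp_all add: Vir_proj_MY)

lemma keys_Vir_proj:
  "Poly_Mapping.keys (Vir_proj x) = Poly_Mapping.keys x \<inter> insert C (range L)"
  by (auto simp: in_keys_iff split: if_splits)

lemma Vir_proj_basis_bracket:
  "Vir_proj (sv_basis_bracket a b) =
    (if a \<in> insert C (range L) \<and> b \<in> insert C (range L) then sv_basis_bracket a b else 0)"
proof (cases "a \<in> insert C (range L) \<and> b \<in> insert C (range L)")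
  case True
  thus ?thesis using Vir_proj_id basis_bracket_Vir[of a b] unfolding Vir_eq by presburger
next
  case False
  hence "a \<in> insert C MY \<or> b \<in> insert C MY" by (cases a; cases b) auto
  thus ?thesis using False Vir_proj_MY[OF basis_bracket_MY] by auto
qed

text \<open>The kernel of the projection is an ideal and its image a subalgebra, so it is a Lie
  algebra homomorphism; this is checked on basis vectors and extended bilinearly.\<close>

lemma Vir_proj_bracket: "Vir_proj (sv_bracket x y) = sv_bracket (Vir_proj x) (Vir_proj y)"
proof -
  let ?V = "insert C (range L)"
  let ?t = "\<lambda>a b. sv_scale (Poly_Mapping.lookup x a * Poly_Mapping.lookup y b) (sv_basis_bracket a b)"
  have "Vir_proj (sv_bracket x y) = (\<Sum>a\<in>Poly_Mapping.keys x. \<Sum>b\<in>Poly_Mapping.keys y.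
      if a \<in> ?V then if b \<in> ?V then ?t a b else 0 else 0)"
    unfolding sv_bracket_def Vir_proj_sum Vir_proj_scale Vir_proj_basis_bracket
    by (intro sum.cong refl) simp
  also have "\<dots> = (\<Sum>a\<in>Poly_Mapping.keys x. if a \<in> ?V then
      \<Sum>b\<in>Poly_Mapping.keys y. if b \<in> ?V then ?t a b else 0 else 0)"
    by (intro sum.cong) auto
  also have "\<dots> = (\<Sum>a\<in>Poly_Mapping.keys x \<inter> ?V. \<Sum>b\<in>Poly_Mapping.keys y \<inter> ?V. ?t a b)"
    by (simp only: sum.inter_restrict[OF finite_keys])
  also have "\<dots> = sv_bracket (Vir_proj x) (Vir_proj y)"
    unfolding sv_bracket_def keys_Vir_proj by (intro sum.cong refl) simp
  finally show ?thesis .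
qed

text \<open>This is the anti-involution that \<open>\<theta>\<close> induces on the quotient by the
  ideal, carried over to \<open>Vir\<close>. It squares to the identity because the part of
  \<open>\<theta> x\<close> that is projected away stays in the ideal under
  \<open>\<theta>\<close>.\<close>

lemma (in anti_involution) conj_anti_involution_Vir:
  "conj_anti_involution Vir (\<lambda>x. Vir_proj (\<theta> x))"
proof -
  have "Vir_proj (\<theta> (Vir_proj (\<theta> x))) = x" if "x \<in> Vir" for x
  proof -
    have "x = Vir_proj (\<theta> (Vir_proj (\<theta> x) + (\<theta> x - Vir_proj (\<theta> x))))"
      using that by (simp add: Vir_proj_id)
    also have "\<dots> = Vir_proj (\<theta> (Vir_proj (\<theta> x))) + Vir_proj (\<theta> (\<theta> x - Vir_proj (\<theta> x)))"
      by (simp only: theta_simps(1) Vir_proj_add)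
    also have "Vir_proj (\<theta> (\<theta> x - Vir_proj (\<theta> x))) = 0"
      by (intro Vir_proj_MY theta_MY Vir_proj_diff_MY)
    finally show ?thesis by simp
  qed
  thus ?thesis
    by (simp add: conj_anti_involution_def Vir_proj_in_Vir Vir_proj_add Vir_proj_scale Vir_proj_bracket)
qed

section \<open>Unitary weight modules\<close>

locale unitary_sv_module = anti_involution \<theta> for \<theta> +
  fixes scale :: "complex \<Rightarrow> 'v::ab_group_add \<Rightarrow> 'v" and act :: "sv \<Rightarrow> 'v \<Rightarrow> 'v"
    and B :: "'v \<Rightarrow> 'v \<Rightarrow> complex"
  assumes weight_module: "weight_module UNIV sv_cartan scale act"
    and form: "pos_def_hermitian_form scale B"
    and adjoint: "B (act x u) v = B u (act (\<theta> x) v)"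
begin

lemma lie_module: "lie_module UNIV scale act"
  using weight_module by (simp add: weight_module_def)

sublocale vector_space scale
  using lie_module by (simp add: lie_module_def)

lemma act_simps:
  "act x (u + v) = act x u + act x v" "act x (scale a v) = scale a (act x v)"
  "act (x + y) v = act x v + act y v" "act (sv_scale a x) v = scale a (act x v)"
  "act (sv_bracket x y) v = act x (act y v) - act y (act x v)"
  using lie_module by (simp_all add: lie_module_def)

lemma act_linear: "Vector_Spaces.linear scale scale (act x)"
  using vector_space_axioms by (simp add: Vector_Spaces.linear_iff act_simps)

lemma act_0 [simp]: "act 0 v = 0" "act x 0 = 0"
  using act_simps(3)[of 0 0 v] act_simps(1)[of x 0 0] by simp_all

lemma act_diff: "act x (u - v) = act x u - act x v"
  using act_simps(1)[of x "u - v" v] by simp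

lemma act_diff_left: "act (x - y) v = act x v - act y v"
  using act_simps(3)[of "x - y" y v] by simp

lemma act_sum: "act (\<Sum>i\<in>I. f i) v = (\<Sum>i\<in>I. act (f i) v)"
  by (induction I rule: infinite_finite_induct) (simp_all add: act_simps)

abbreviation E :: "sv_basis \<Rightarrow> 'v \<Rightarrow> 'v" where
  "E b \<equiv> act (sv_elem b)"

lemma act_expansion:
  "act x v = (\<Sum>b\<in>Poly_Mapping.keys x. scale (Poly_Mapping.lookup x b) (E b v))"
  by (subst sv_expansion) (simp add: act_sum act_simps)

lemma act_eq_0:
  assumes "\<And>b v. b \<in> S \<Longrightarrow> E b v = 0" "x \<in> sv_supp S"
  shows "act x v = 0"
  using assms by (subst act_expansion) (auto simp: sv_supp_def intro!: sum.neutral)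

lemma act_swap: "act x (act y v) = act y (act x v) + act (sv_bracket x y) v"
  by (simp add: act_simps)

lemma E_swap: "E a (E b v) = E b (E a v) + act (sv_basis_bracket a b) v"
  using act_swap[of "sv_elem a" "sv_elem b"] by (simp add: sv_bracket_elem)

lemma E_swap_LM: "E (L m) (E (M n) v) = E (M n) (E (L m) v) + scale (of_int n) (E (M (n + m)) v)"
  by (subst E_swap) (simp add: act_simps)

lemma E_swap_LY:
  "E (L m) (E (Y n) v) = E (Y n) (E (L m) v) + scale (of_int n + (1 - of_int m) / 2) (E (Y (m + n)) v)"
  by (subst E_swap) (simp only: act_simps sv_basis_bracket.simps)

lemma E_swap_YY:
  "E (Y m) (E (Y n) v) = E (Y n) (E (Y m) v) + scale (of_int (n - m)) (E (M (m + n + 1)) v)"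
  by (subst E_swap) (simp only: act_simps sv_basis_bracket.simps)

lemma E_swap_MY: "E (M m) (E (Y n) v) = E (Y n) (E (M m) v)"
  by (subst E_swap) simp

lemma E_swap_MM: "E (M m) (E (M n) v) = E (M n) (E (M m) v)"
  by (subst E_swap) simp

lemma E_swap_C: "E C (E b v) = E b (E C v)"
  by (subst E_swap) simp

section \<open>Weight spaces and homogeneous operators\<close>

abbreviation W :: "(sv \<Rightarrow> complex) \<Rightarrow> 'v set" where
  "W \<equiv> weight_space sv_cartan scale act"

text \<open>Every vector is a finite sum of weight vectors, so an operator may be shown to vanish on
  one finite-dimensional weight space at a time.\<close>

lemma weight_induct:
  assumes "Vector_Spaces.linear scale scale f"
    and "\<And>wt u. wt \<in> dual_space sv_cartan \<Longrightarrow> u \<in> W wt \<Longrightarrow> f u = 0"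
  shows "f v = 0"
proof -
  interpret f: Vector_Spaces.linear scale scale f by fact
  obtain g where g: "\<forall>wt\<in>dual_space sv_cartan. g wt \<in> W wt"
      "\<forall>wt. wt \<notin> dual_space sv_cartan \<longrightarrow> g wt = 0" "v = (\<Sum>wt | g wt \<noteq> 0. g wt)"
    using weight_module unfolding weight_module_def by blast
  have "f (g wt) = 0" for wt
    using assms(2) g(1,2) f.zero by metis
  thus ?thesis by (subst g(3)) (simp add: f.sum)
qed

lemma weight_space_span:
  assumes "wt \<in> dual_space sv_cartan"
  obtains F where "finite F" "W wt = span F"
  using weight_module assms unfolding weight_module_def by blast

text \<open>The degree is the one of the \<open>L 0\<close> grading, in which \<open>Y n\<close> has
  degree \<open>n + 1/2\<close>. For instance \<open>Y 0\<close> followed or preceded by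
  \<open>Y (-1)\<close> has degree 0 and so preserves weight spaces.\<close>

definition homog :: "complex \<Rightarrow> ('v \<Rightarrow> 'v) \<Rightarrow> bool" where
  "homog d f \<longleftrightarrow> Vector_Spaces.linear scale scale f \<and>
    (\<forall>v. E (L 0) (f v) = f (E (L 0) v) + scale d (f v)) \<and>
    (\<forall>v. E (M 0) (f v) = f (E (M 0) v)) \<and> (\<forall>v. E C (f v) = f (E C v))"

lemma homog_M: "homog (of_int n) (E (M n))"
  by (simp add: homog_def act_linear E_swap_LM E_swap_MM E_swap_C)

lemma homog_Y: "homog (of_int n + 1 / 2) (E (Y n))"
  by (simp add: homog_def act_linear E_swap_LY E_swap_MY E_swap_C)

lemma homog_comp:
  assumes "homog d f" "homog d' g"
  shows "homog (d + d') (\<lambda>v. f (g v))"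
  using assms unfolding homog_def Vector_Spaces.linear_iff
  by (simp add: scale_left_distrib algebra_simps)

lemma homog_0_weight_space:
  assumes f: "homog 0 f" and v: "v \<in> W wt"
  shows "f v \<in> W wt"
proof -
  interpret f: Vector_Spaces.linear scale scale f using f by (simp add: homog_def)
  have comm: "E b (f v) = f (E b v)" if "b \<in> {L 0, M 0, C}" for b
    using f that by (auto simp: homog_def)
  have "act x (f v) = f (act x v)" if "x \<in> sv_cartan" for x
  proof -
    have "Poly_Mapping.keys x \<subseteq> {L 0, M 0, C}"
      using that by (simp add: sv_cartan_eq sv_supp_def)
    hence "(\<Sum>b\<in>Poly_Mapping.keys x. scale (Poly_Mapping.lookup x b) (E b (f v))) =
        (\<Sum>b\<in>Poly_Mapping.keys x. scale (Poly_Mapping.lookup x b) (f (E b v)))"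
      using comm by (intro sum.cong) auto
    thus ?thesis by (simp add: act_expansion[of x] f.sum f.scale)
  qed
  thus ?thesis using v by (simp add: weight_space_def f.scale)
qed

lemma homog_0_annihilating_poly:
  assumes f: "homog 0 f" and u: "wt \<in> dual_space sv_cartan" "u \<in> W wt"
  obtains p where "p \<noteq> 0" "lin_endo.poly_op scale f p u = 0"
proof -
  interpret f: lin_endo scale f using f by (simp add: homog_def lin_endo_def)
  obtain F where F: "finite F" "W wt = span F" using weight_space_span u(1) .
  show ?thesis
    using f.ex_annihilating_poly[OF F(1), of u] homog_0_weight_space[OF f, of _ wt] u(2) F(2) that
    by auto
qed

text \<open>All combinations of the \<open>M n\<close> are taken as generators, because
  \<open>\<theta>\<close> may send a basis vector to a combination of several.\<close>

lemma star_ops_M: "star_ops scale B (act ` sv_supp (range M))"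
proof unfold_locales
  fix f g v assume "f \<in> act ` sv_supp (range M)" "g \<in> act ` sv_supp (range M)"
  then obtain x y where "x \<in> sv_supp (range M)" "y \<in> sv_supp (range M)" "f = act x" "g = act y"
    by blast
  moreover from this have "sv_bracket x y = 0"
    by (intro bracket_M_MY) (auto simp: sv_supp_def)
  ultimately show "f (g v) = g (f v)" using act_swap[of x y v] by simp
qed (use form act_linear adjoint theta_M in \<open>auto simp: act_simps\<close>)

text \<open>Brackets of \<open>Y\<close> vectors lie in the span of the \<open>M\<close> vectors, so
  the operators commute once \<open>M\<close> acts by zero.\<close>

lemma star_ops_MY:
  assumes "\<And>n v. E (M n) v = 0"
  shows "star_ops scale B (act ` sv_supp MY)"
proof unfold_locales
  fix f g v assume "f \<in> act ` sv_supp MY" "g \<in> act ` sv_supp MY"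
  then obtain x y where "x \<in> sv_supp MY" "y \<in> sv_supp MY" "f = act x" "g = act y"
    by blast
  moreover from this have "act (sv_bracket x y) v = 0"
    using assms by (intro act_eq_0[OF _ bracket_MY_MY]) auto
  ultimately show "f (g v) = g (f v)" using act_swap[of x y v] by simp
qed (use form act_linear adjoint theta_MY in \<open>auto simp: act_simps\<close>)

text \<open>Since \<open>[L (k - n), M n] = n M k\<close>, \<open>derivation_kernel\<close> with
  \<open>D = L (k - n)\<close> puts the kernel of \<open>M n\<close> inside that of
  \<open>M k\<close>.\<close>

lemma M_kernel:
  assumes "n \<noteq> 0" "E (M n) v = 0"
  shows "E (M k) v = 0"
proof -
  interpret star_ops scale B "act ` sv_supp (range M)" by (rule star_ops_M)
  have gen: "E (M j) \<in> op_alg scale (act ` sv_supp (range M))" for j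
    by (rule op_alg.gen) simp
  have "scale (of_int n) (E (M k) v) = 0"
    by (rule derivation_kernel[of "E (L (k - n))" "E (M n)" "\<lambda>v. scale (of_int n) (E (M k) v)"])
      (simp_all add: assms E_swap_LM gen op_alg.comp[OF op_alg.smul gen])
  thus ?thesis using assms(1) by simp
qed

text \<open>If \<open>M 0\<close> acts as \<open>z \<noteq> 0\<close>, then \<open>Y (-1)\<close> and \<open>Y 0\<close> satisfy the Heisenberg relation. The
  even operators \<open>Y 0 ^ 2\<close> and \<open>Y (-1) ^ 2\<close>, brought back to degree zero by the injective
  \<open>M (-1)\<close> and \<open>M 1\<close>, shift the eigenvalues of \<open>Y 0 Y (-1)\<close> by \<open>2 z\<close> and \<open>- 2 z\<close>;
  these shifts cannot both stop on a finite-dimensional weight space.\<close>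

lemma M_0_eq_0: "E (M 0) v = 0"
proof (rule weight_induct[OF act_linear])
  fix wt u assume wt: "wt \<in> dual_space sv_cartan" and u: "u \<in> W wt"
  define z where "z = wt (sv_elem (M 0))"
  have z: "E (M 0) w = scale z w" if "w \<in> W wt" for w
    using that by (auto simp: weight_space_def z_def sv_cartan_eq)
  show "E (M 0) u = 0"
  proof (rule ccontr)
    assume "E (M 0) u \<noteq> 0"
    hence z0: "z \<noteq> 0" and u0: "u \<noteq> 0" using z[OF u] by auto
    define P where "P = E (Y 0)"
    define Q where "Q = E (Y (- 1))"
    have lin: "P (scale a w) = scale a (P w)" "Q (scale a w) = scale a (Q w)" "P 0 = 0" "Q 0 = 0"
      "Q (v + w) = Q v + Q w" "P (v + w) = P v + P w" "Q (v - w) = Q v - Q w" for a v w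
      unfolding P_def Q_def
      by (simp_all add: act_simps act_diff)
    \<comment> \<open>\<open>P\<close> and \<open>Q\<close> shift the \<open>L 0\<close> weight and
      so leave the weight space, but they stay in this eigenspace of \<open>M 0\<close>.\<close>
    define K where "K = {w. E (M 0) w = scale z w}"
    have K: "P w \<in> K" "Q w \<in> K" if "w \<in> K" for w
      using that by (simp_all add: K_def P_def Q_def E_swap_MY act_simps)
    have WK: "w \<in> K" if "w \<in> W wt" for w using z[OF that] by (simp add: K_def)
    have QP: "Q (P w) = P (Q w) + scale z w" if "w \<in> K" for w
      using that E_swap_YY[of "- 1" 0 w] by (simp add: K_def P_def Q_def)
    have M_comm: "P (E (M n) w) = E (M n) (P w)" "Q (E (M n) w) = E (M n) (Q w)" for n w
      by (simp_all add: P_def Q_def E_swap_MY)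
    \<comment> \<open>By \<open>M_kernel\<close> such a \<open>w\<close> is also killed by
      \<open>M 0\<close>, which is the nonzero scalar \<open>z\<close> on \<open>K\<close>.\<close>
    have M_inj: "w = 0" if "E (M n) w = 0" "w \<in> K" "n \<noteq> 0" for n w
      using M_kernel[OF that(3,1), of 0] that(2) z0 by (simp add: K_def)
    define H where "H w = P (Q w)" for w
    have hH: "homog 0 H"
      using homog_comp[OF homog_Y[of 0] homog_Y[of "- 1"]] by (simp add: H_def[abs_def] P_def Q_def)
    have hU: "homog 0 (\<lambda>w. E (M (- 1)) (P (P w)))"
      using homog_comp[OF homog_M[of "- 1"] homog_comp[OF homog_Y[of 0] homog_Y[of 0]]]
      by (simp add: P_def)
    have hD: "homog 0 (\<lambda>w. E (M 1) (Q (Q w)))"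
      using homog_comp[OF homog_M[of 1] homog_comp[OF homog_Y[of "- 1"] homog_Y[of "- 1"]]]
      by (simp add: Q_def)
    define \<Sigma> where "\<Sigma> = {h. \<exists>w\<in>W wt. w \<noteq> 0 \<and> H w = scale h w}"
    interpret H: lin_endo scale H using hH by (simp add: homog_def lin_endo_def)
    obtain F where F: "finite F" "W wt = span F" using weight_space_span wt .
    have H_span: "H w \<in> span F" if "w \<in> span F" for w
      using homog_0_weight_space[OF hH, of w wt] that F(2) by simp
    have fin: "finite \<Sigma>"
      unfolding \<Sigma>_def F(2) using H.finite_eigenvalues[OF F(1) H_span] .
    have "\<exists>a. poly p a = 0" if "degree p > 0" for p :: "complex poly"
      using fundamental_theorem_of_algebra that by (auto simp: constant_degree)
    hence nonempty: "\<Sigma> \<noteq> {}"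
      unfolding \<Sigma>_def F(2) using H.ex_eigenvector[OF _ F(1) H_span, of u] u u0 F(2) by blast
    \<comment> \<open>From \<open>Q P = P Q + z\<close> follows
      \<open>Q P^2 w = (h + 2 z) P w\<close>. The raising stops only if \<open>P w = 0\<close>,
      giving \<open>h = - z\<close>, or if \<open>P^2 w = 0\<close> with \<open>P w\<close> nonzero,
      giving \<open>h = - 2 z\<close>.\<close>
    have up: "h + 2 * z \<in> \<Sigma> \<or> h = - z \<or> h = - 2 * z" if "h \<in> \<Sigma>" for h
    proof -
      obtain w where w: "w \<in> W wt" "w \<noteq> 0" "P (Q w) = scale h w"
        using \<open>h \<in> \<Sigma>\<close> by (auto simp: \<Sigma>_def H_def)
      note wK = WK[OF w(1)]
      have "Q (P (P w)) = scale h (P w) + scale z (P w) + scale z (P w)"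
        by (simp add: QP K wK w(3) lin)
      also have "\<dots> = scale (h + 2 * z) (P w)"
        by (simp only: scale_left_distrib mult_2 add.assoc)
      finally have 1: "Q (P (P w)) = scale (h + 2 * z) (P w)" .
      show ?thesis
      proof (cases "P (P w) = 0")
        case True
        hence "h + 2 * z = 0 \<or> P w = 0" using 1 by (simp add: lin)
        moreover have "h + z = 0" if "P w = 0"
        proof -
          have "scale (h + z) w = 0"
            using QP[OF wK] that by (simp add: lin w(3) scale_left_distrib)
          thus ?thesis using w(2) by simp
        qed
        ultimately show ?thesis by (auto simp: eq_neg_iff_add_eq_0)
      next
        case False
        define w' where "w' = E (M (- 1)) (P (P w))"
        have "w' \<noteq> 0" using M_inj[of "- 1" "P (P w)"] False K wK by (auto simp: w'_def)
        moreover have "H w' = scale (h + 2 * z) w'"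
          by (simp add: H_def w'_def M_comm 1 lin act_simps)
        moreover have "w' \<in> W wt"
          unfolding w'_def using homog_0_weight_space[OF hU w(1)] .
        ultimately show ?thesis by (auto simp: \<Sigma>_def)
      qed
    qed
    \<comment> \<open>Dually \<open>P Q^2 w = (h - z) Q w\<close>; the lowering stops only if
      \<open>Q w = 0\<close>, giving \<open>h = 0\<close>, or if \<open>Q^2 w = 0\<close> with
      \<open>Q w\<close> nonzero, giving \<open>h = z\<close>.\<close>
    have down: "h - 2 * z \<in> \<Sigma> \<or> h = z \<or> h = 0" if "h \<in> \<Sigma>" for h
    proof -
      obtain w where w: "w \<in> W wt" "w \<noteq> 0" "P (Q w) = scale h w"
        using \<open>h \<in> \<Sigma>\<close> by (auto simp: \<Sigma>_def H_def)
      note wK = WK[OF w(1)]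
      have PQ: "P (Q w) = Q (P w) - scale z w" if "w \<in> K" for w using QP[OF that] by simp
      have 1: "P (Q (Q w)) = scale (h - z) (Q w)"
      proof -
        have "P (Q (Q w)) = Q (P (Q w)) - scale z (Q w)" by (rule PQ) (rule K[OF wK])
        thus ?thesis by (simp add: w(3) lin scale_left_diff_distrib)
      qed
      show ?thesis
      proof (cases "Q (Q w) = 0")
        case True
        hence "h - z = 0 \<or> Q w = 0" using 1 by (simp add: lin)
        thus ?thesis using w by (auto simp: lin)
      next
        case False
        define w' where "w' = E (M 1) (Q (Q w))"
        have "w' \<noteq> 0" using M_inj[of 1 "Q (Q w)"] False K wK by (auto simp: w'_def)
        moreover have "H w' = scale (h - 2 * z) w'"
        proof -
          have "P (Q (Q (Q w))) = Q (P (Q (Q w))) - scale z (Q (Q w))"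
            by (rule PQ) (intro K wK)
          also have "\<dots> = scale (h - z - z) (Q (Q w))"
            by (simp only: 1 lin scale_left_diff_distrib)
          also have "h - z - z = h - 2 * z" by simp
          finally show ?thesis by (simp add: H_def w'_def M_comm act_simps)
        qed
        moreover have "w' \<in> W wt"
          unfolding w'_def using homog_0_weight_space[OF hD w(1)] .
        ultimately show ?thesis by (auto simp: \<Sigma>_def)
      qed
    qed
    \<comment> \<open>Division by \<open>z\<close> turns the shifts into 2 and -2. At a maximum of
      \<open>?r\<close> raising stops, so the maximum is -1 or -2; at a minimum lowering stops, so
      the minimum is 0 or 1.\<close>
    let ?r = "\<lambda>h. Re (h / z)"
    have shift: "?r (h + 2 * z) = ?r h + 2" "?r (h - 2 * z) = ?r h - 2" for h
      using z0 by (simp_all add: add_divide_distrib diff_divide_distrib)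
    have "Max (?r ` \<Sigma>) \<in> ?r ` \<Sigma>"
      using fin nonempty by (intro Max_in) auto
    then obtain h where "Max (?r ` \<Sigma>) = ?r h" "h \<in> \<Sigma>" by (rule imageE)
    note h = this(2) this(1)[symmetric]
    have "h + 2 * z \<notin> \<Sigma>"
    proof
      assume "h + 2 * z \<in> \<Sigma>"
      hence "?r (h + 2 * z) \<le> Max (?r ` \<Sigma>)" using fin by (intro Max_ge) auto
      thus False using h(2) shift(1)[of h] by linarith
    qed
    hence h1: "?r h < 0" using up[OF h(1)] z0 by auto
    have "Min (?r ` \<Sigma>) \<in> ?r ` \<Sigma>"
      using fin nonempty by (intro Min_in) auto
    then obtain g where "Min (?r ` \<Sigma>) = ?r g" "g \<in> \<Sigma>" by (rule imageE)
    note g = this(2) this(1)[symmetric]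
    have "g - 2 * z \<notin> \<Sigma>"
    proof
      assume "g - 2 * z \<in> \<Sigma>"
      hence "Min (?r ` \<Sigma>) \<le> ?r (g - 2 * z)" using fin by (intro Min_le) auto
      thus False using g(2) shift(2)[of g] by linarith
    qed
    hence "?r g \<ge> 0" using down[OF g(1)] z0 by auto
    moreover have "?r g \<le> ?r h" unfolding h(2) using fin g(1) by (intro Max_ge) auto
    ultimately show False using h1 by linarith
  qed
qed

lemma M_eq_0: "E (M n) v = 0"
proof (rule weight_induct[OF act_linear])
  fix wt u assume wt: "wt \<in> dual_space sv_cartan" "u \<in> W wt"
  interpret star_ops scale B "act ` sv_supp (range M)" by (rule star_ops_M)
  have gen: "E (M j) \<in> op_alg scale (act ` sv_supp (range M))" for j
    by (rule op_alg.gen) simp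
  have alg: "(\<lambda>v. E (M i) (E (M j) v)) \<in> op_alg scale (act ` sv_supp (range M))" for i j
    by (rule op_alg.comp[OF gen gen])
  have homog: "homog 0 (\<lambda>v. E (M 1) (E (M (- 1)) v))"
    using homog_comp[OF homog_M[of 1] homog_M[of "- 1"]] by simp
  obtain p where p: "p \<noteq> 0" "lin_endo.poly_op scale (\<lambda>v. E (M 1) (E (M (- 1)) v)) p u = 0"
    using homog_0_annihilating_poly[OF homog wt] .
  \<comment> \<open>The commutator of \<open>L 1\<close> with \<open>M 1 M (-1)\<close> is
    \<open>M 2 M (-1) - M 1 M 0\<close>, and \<open>M 0\<close> acts by zero.\<close>
  have "E (M 2) (E (M (- 1)) u) = 0"
    by (rule derivation_eq_0[of "E (L 1)" _ "\<lambda>v. E (M 2) (E (M (- 1)) v)", OF act_linear alg alg _ p])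
      (simp add: E_swap_LM act_diff M_0_eq_0)
  hence "E (M (- 1)) (E (M (- 1)) u) = 0" by (rule M_kernel[of 2, rotated]) simp
  hence "E (M (- 1)) u = 0" by (rule op_square_eq_0[OF gen])
  thus "E (M n) u = 0" by (rule M_kernel[of "- 1", rotated]) simp
qed

lemma Y_0_eq_0: "E (Y 0) v = 0"
proof (rule weight_induct[OF act_linear])
  fix wt u assume wt: "wt \<in> dual_space sv_cartan" "u \<in> W wt"
  interpret star_ops scale B "act ` sv_supp MY" by (rule star_ops_MY) (rule M_eq_0)
  have gen: "E (Y j) \<in> op_alg scale (act ` sv_supp MY)" for j
    by (rule op_alg.gen) simp
  have alg: "(\<lambda>v. E (Y i) (E (Y j) v)) \<in> op_alg scale (act ` sv_supp MY)" for i j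
    by (rule op_alg.comp[OF gen gen])
  have homog: "homog 0 (\<lambda>v. E (Y 0) (E (Y (- 1)) v))"
    using homog_comp[OF homog_Y[of 0] homog_Y[of "- 1"]] by simp
  obtain p where p: "p \<noteq> 0" "lin_endo.poly_op scale (\<lambda>v. E (Y 0) (E (Y (- 1)) v)) p u = 0"
    using homog_0_annihilating_poly[OF homog wt] .
  \<comment> \<open>As \<open>[L 1, Y n] = n Y (n + 1)\<close>, the factor \<open>Y 0\<close>
    contributes nothing and \<open>Y (-1)\<close> contributes \<open>- Y 0\<close>.\<close>
  have "scale (- 1) (E (Y 0) (E (Y 0) u)) = 0"
    by (rule derivation_eq_0[of "E (L 1)" _ "\<lambda>v. scale (- 1) (E (Y 0) (E (Y 0) v))",
          OF act_linear alg op_alg.comp[OF op_alg.smul alg] _ p])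
      (simp add: E_swap_LY act_diff)
  hence "E (Y 0) (E (Y 0) u) = 0" by simp
  thus "E (Y 0) u = 0" by (rule op_square_eq_0[OF gen])
qed

lemma Y_shift:
  assumes "\<And>v. E (Y n) v = 0" "m \<noteq> 2 * n + 1"
  shows "E (Y (m + n)) v = 0"
proof -
  have "of_int (2 * n + 1 - m) \<noteq> (0 :: complex)" using assms(2) unfolding of_int_eq_0_iff by simp
  hence "of_int n + (1 - of_int m) / 2 \<noteq> (0 :: complex)" by (auto simp: field_simps)
  thus ?thesis using E_swap_LY[of m n v] assms(1) by simp
qed

text \<open>A bracket of \<open>L m\<close> with \<open>Y 0\<close> reaches every \<open>Y m\<close>
  except \<open>Y 1\<close>; that one is reached from \<open>Y (-1)\<close> with
  \<open>L 2\<close>.\<close>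

lemma Y_eq_0: "E (Y n) v = 0"
proof (cases "n = 1")
  case True
  have "E (Y (- 1)) v = 0" for v using Y_shift[OF Y_0_eq_0, of "- 1"] by simp
  hence "E (Y (2 + - 1)) v = 0" by (intro Y_shift) simp_all
  thus ?thesis using True by simp
next
  case False
  thus ?thesis using Y_shift[OF Y_0_eq_0, of n] by simp
qed

lemma MY_eq_0: "x \<in> sv_supp MY \<Longrightarrow> act x v = 0"
  by (rule act_eq_0[of MY]) (auto simp: M_eq_0 Y_eq_0)

end

section \<open>Weights of the Virasoro algebra\<close>

text \<open>Together with \<open>res_weight\<close> this identifies weights of
  \<open>Vir_cartan\<close> with the weights of \<open>sv_cartan\<close> that vanish on
  \<open>M 0\<close>. The restriction makes the result extensional, as \<open>dual_space\<close>
  demands.\<close>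

definition ext_weight :: "(sv \<Rightarrow> complex) \<Rightarrow> sv \<Rightarrow> complex" where
  "ext_weight wt = restrict (\<lambda>x. wt (Vir_proj x)) sv_cartan"

definition res_weight :: "(sv \<Rightarrow> complex) \<Rightarrow> sv \<Rightarrow> complex" where
  "res_weight wt = restrict wt Vir_cartan"

lemma Vir_cartan_closed:
  "x \<in> Vir_cartan \<Longrightarrow> y \<in> Vir_cartan \<Longrightarrow> x + y \<in> Vir_cartan"
  "x \<in> Vir_cartan \<Longrightarrow> sv_scale a x \<in> Vir_cartan"
  by (simp_all add: Vir_cartan_def sv.span_add sv.span_scale)

lemma sv_cartan_closed:
  "x \<in> sv_cartan \<Longrightarrow> y \<in> sv_cartan \<Longrightarrow> x + y \<in> sv_cartan"
  "x \<in> sv_cartan \<Longrightarrow> sv_scale a x \<in> sv_cartan"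
  by (simp_all add: sv_cartan_def sv.span_add sv.span_scale)

lemma Vir_cartan_subset: "Vir_cartan \<subseteq> sv_cartan" "Vir_cartan \<subseteq> Vir"
  by (auto simp: Vir_cartan_eq sv_cartan_eq Vir_eq sv_supp_def)

lemma Vir_proj_cartan: "x \<in> sv_cartan \<Longrightarrow> Vir_proj x \<in> Vir_cartan"
  by (auto simp: sv_cartan_eq Vir_cartan_eq sv_supp_def keys_Vir_proj)

lemma sv_cartan_expansion:
  assumes "x \<in> sv_cartan"
  shows "x = Vir_proj x + sv_scale (Poly_Mapping.lookup x (M 0)) (sv_elem (M 0))"
proof (rule poly_mapping_eqI)
  fix b
  show "Poly_Mapping.lookup x b = Poly_Mapping.lookup
      (Vir_proj x + sv_scale (Poly_Mapping.lookup x (M 0)) (sv_elem (M 0))) b"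
    using assms by (cases b) (auto simp: lookup_add sv_cartan_eq sv_supp_def in_keys_iff)
qed

lemma M_0_in_sv_cartan: "sv_elem (M 0) \<in> sv_cartan"
  by (simp add: sv_cartan_eq)

lemma ext_weight_dual:
  assumes "wt \<in> dual_space Vir_cartan"
  shows "ext_weight wt \<in> dual_space sv_cartan" "ext_weight wt (sv_elem (M 0)) = 0"
proof -
  show "ext_weight wt \<in> dual_space sv_cartan"
    using assms
    by (simp add: dual_space_def ext_weight_def sv_cartan_closed Vir_proj_cartan Vir_proj_add
        Vir_proj_scale)
  \<comment> \<open>Homogeneity with scalar 0 supplies \<open>wt 0 = 0\<close>.\<close>
  have "wt (sv_scale 0 0) = 0 * wt 0"
    using assms unfolding dual_space_def
    by (simp add: Vir_cartan_eq del: sv.scale_zero_left sv.scale_zero_right)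
  moreover have "Vir_proj (sv_elem (M 0)) = 0" by (intro Vir_proj_MY) simp
  ultimately show "ext_weight wt (sv_elem (M 0)) = 0"
    by (simp add: ext_weight_def M_0_in_sv_cartan)
qed

lemma res_weight_dual: "wt \<in> dual_space sv_cartan \<Longrightarrow> res_weight wt \<in> dual_space Vir_cartan"
  using Vir_cartan_subset(1)
  by (auto simp: dual_space_def res_weight_def Vir_cartan_closed subset_iff)

lemma res_ext_weight:
  assumes "wt \<in> dual_space Vir_cartan"
  shows "res_weight (ext_weight wt) = wt"
proof
  fix x
  show "res_weight (ext_weight wt) x = wt x"
    using assms Vir_cartan_subset Vir_proj_id[of x]
    by (cases "x \<in> Vir_cartan")
      (auto simp: res_weight_def ext_weight_def dual_space_def extensional_def)
qed

lemma ext_res_weight: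
  assumes wt: "wt \<in> dual_space sv_cartan" "wt (sv_elem (M 0)) = 0"
  shows "ext_weight (res_weight wt) = wt"
proof
  fix x
  show "ext_weight (res_weight wt) x = wt x"
  proof (cases "x \<in> sv_cartan")
    case True
    have "wt x = wt (Vir_proj x + sv_scale (Poly_Mapping.lookup x (M 0)) (sv_elem (M 0)))"
      using sv_cartan_expansion[OF True] by simp
    also have "\<dots> = wt (Vir_proj x)"
      using wt Vir_proj_cartan[OF True] Vir_cartan_subset(1)
      by (auto simp: dual_space_def sv_cartan_closed M_0_in_sv_cartan)
    finally show ?thesis using True by (simp add: ext_weight_def res_weight_def Vir_proj_cartan)
  next
    case False
    thus ?thesis using wt by (simp add: ext_weight_def dual_space_def extensional_def)
  qed
qed

section \<open>Restriction of the module to the Virasoro algebra\<close>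

context unitary_sv_module
begin

lemma act_Vir_proj: "act (Vir_proj x) v = act x v"
  using act_diff_left[of x "Vir_proj x" v] MY_eq_0[OF Vir_proj_diff_MY] by simp

lemma weight_space_ext:
  assumes "wt \<in> dual_space Vir_cartan"
  shows "W (ext_weight wt) = weight_space Vir_cartan scale act wt"
proof (intro equalityI subsetI)
  fix v assume v: "v \<in> W (ext_weight wt)"
  have "act x v = scale (wt x) v" if "x \<in> Vir_cartan" for x
    using v that Vir_cartan_subset Vir_proj_id[of x]
    by (auto simp: weight_space_def ext_weight_def subset_iff)
  thus "v \<in> weight_space Vir_cartan scale act wt" by (simp add: weight_space_def)
next
  fix v assume "v \<in> weight_space Vir_cartan scale act wt"
  hence "act (Vir_proj x) v = scale (wt (Vir_proj x)) v" if "x \<in> sv_cartan" for x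
    using that by (simp add: weight_space_def Vir_proj_cartan)
  thus "v \<in> W (ext_weight wt)"
    by (simp add: weight_space_def ext_weight_def act_Vir_proj)
qed

lemma weight_M_0:
  assumes "v \<in> W wt" "v \<noteq> 0"
  shows "wt (sv_elem (M 0)) = 0"
proof -
  have "scale (wt (sv_elem (M 0))) v = E (M 0) v"
    using assms(1) M_0_in_sv_cartan by (simp add: weight_space_def)
  thus ?thesis using assms(2) by (simp add: M_eq_0)
qed

text \<open>The condition under the unique existence quantifier of \<open>weight_module\<close>,
  named so that it can be carried between the two Cartan subalgebras.\<close>

definition weight_decomp :: "sv set \<Rightarrow> 'v \<Rightarrow> ((sv \<Rightarrow> complex) \<Rightarrow> 'v) \<Rightarrow> bool" where
  "weight_decomp h v f \<longleftrightarrow>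
     (\<forall>wt\<in>dual_space h. f wt \<in> weight_space h scale act wt) \<and>
     (\<forall>wt. wt \<notin> dual_space h \<longrightarrow> f wt = 0) \<and>
     finite {wt. f wt \<noteq> 0} \<and> v = (\<Sum>wt | f wt \<noteq> 0. f wt)"

lemma zero_weight_space: "0 \<in> weight_space h scale act wt"
  by (simp add: weight_space_def)

text \<open>Transfers uniqueness: two decompositions for \<open>Vir_cartan\<close> extend to
  decompositions for \<open>sv_cartan\<close>, which must agree. Weights not vanishing on
  \<open>M 0\<close> receive the component 0.\<close>

lemma weight_decomp_ext:
  assumes "weight_decomp Vir_cartan v g"
  shows "weight_decomp sv_cartan v
    (\<lambda>wt. if wt \<in> dual_space sv_cartan \<and> wt (sv_elem (M 0)) = 0 then g (res_weight wt) else 0)"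
    (is "weight_decomp _ _ ?f")
proof -
  have g: "g wt \<in> weight_space Vir_cartan scale act wt" if "wt \<in> dual_space Vir_cartan" for wt
    using assms that by (simp add: weight_decomp_def)
  have supp: "wt \<in> dual_space Vir_cartan" if "g wt \<noteq> 0" for wt
    using assms that by (auto simp: weight_decomp_def)
  have "?f wt \<in> W wt" if "wt \<in> dual_space sv_cartan" for wt
  proof (cases "wt (sv_elem (M 0)) = 0")
    case True
    have "g (res_weight wt) \<in> W (ext_weight (res_weight wt))"
      using weight_space_ext g res_weight_dual[OF that] by simp
    thus ?thesis using True that by (simp add: ext_res_weight)
  qed (simp add: zero_weight_space)
  moreover have "{wt. ?f wt \<noteq> 0} \<subseteq> ext_weight ` {wt. g wt \<noteq> 0}"
  proof
    fix wt assume "wt \<in> {wt. ?f wt \<noteq> 0}"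
    hence "wt = ext_weight (res_weight wt)" "g (res_weight wt) \<noteq> 0"
      by (auto simp: ext_res_weight split: if_splits)
    thus "wt \<in> ext_weight ` {wt. g wt \<noteq> 0}" by blast
  qed
  hence "finite {wt. ?f wt \<noteq> 0}"
    by (rule finite_subset) (use assms in \<open>simp add: weight_decomp_def\<close>)
  moreover have "v = (\<Sum>wt | g wt \<noteq> 0. g wt)"
    using assms by (simp add: weight_decomp_def)
  moreover have "(\<Sum>wt | g wt \<noteq> 0. g wt) = (\<Sum>wt | ?f wt \<noteq> 0. ?f wt)"
    by (rule sum.reindex_bij_witness[of _ res_weight ext_weight])
      (use supp ext_weight_dual res_ext_weight ext_res_weight in \<open>auto split: if_splits\<close>)
  ultimately show ?thesis unfolding weight_decomp_def by simp
qed

text \<open>Transfers existence. No component is lost, because \<open>M 0\<close> acts by zero and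
  so every weight with a nonzero component vanishes on \<open>M 0\<close>.\<close>

lemma weight_decomp_res:
  assumes "weight_decomp sv_cartan v f"
  shows "weight_decomp Vir_cartan v
    (\<lambda>wt. if wt \<in> dual_space Vir_cartan then f (ext_weight wt) else 0)"
    (is "weight_decomp _ _ ?g")
proof -
  have supp: "wt \<in> dual_space sv_cartan" "wt (sv_elem (M 0)) = 0" if "f wt \<noteq> 0" for wt
    using assms that weight_M_0[of "f wt" wt] by (auto simp: weight_decomp_def)
  have "?g wt \<in> weight_space Vir_cartan scale act wt" if "wt \<in> dual_space Vir_cartan" for wt
    using assms that ext_weight_dual(1)[OF that]
    by (simp add: weight_decomp_def flip: weight_space_ext)
  moreover have "{wt. ?g wt \<noteq> 0} \<subseteq> res_weight ` {wt. f wt \<noteq> 0}"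
  proof
    fix wt assume "wt \<in> {wt. ?g wt \<noteq> 0}"
    hence "wt = res_weight (ext_weight wt)" "f (ext_weight wt) \<noteq> 0"
      by (auto simp: res_ext_weight split: if_splits)
    thus "wt \<in> res_weight ` {wt. f wt \<noteq> 0}" by blast
  qed
  hence "finite {wt. ?g wt \<noteq> 0}"
    by (rule finite_subset) (use assms in \<open>simp add: weight_decomp_def\<close>)
  moreover have "v = (\<Sum>wt | f wt \<noteq> 0. f wt)"
    using assms by (simp add: weight_decomp_def)
  moreover have "(\<Sum>wt | f wt \<noteq> 0. f wt) = (\<Sum>wt | ?g wt \<noteq> 0. ?g wt)"
    by (rule sum.reindex_bij_witness[of _ ext_weight res_weight])
      (use supp res_weight_dual res_ext_weight ext_res_weight in \<open>auto split: if_splits\<close>)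
  ultimately show ?thesis unfolding weight_decomp_def by simp
qed

lemma weight_module_Vir: "weight_module Vir Vir_cartan scale act"
proof -
  have sv: "\<exists>!f. weight_decomp sv_cartan v f" for v
    using weight_module unfolding weight_module_def weight_decomp_def by blast
  have "\<exists>!g. weight_decomp Vir_cartan v g" for v
  proof (rule ex_ex1I)
    show "\<exists>g. weight_decomp Vir_cartan v g" using sv weight_decomp_res by blast
  next
    fix g g' assume g: "weight_decomp Vir_cartan v g" "weight_decomp Vir_cartan v g'"
    let ?e = "\<lambda>g wt. if wt \<in> dual_space sv_cartan \<and> wt (sv_elem (M 0)) = 0
      then g (res_weight wt) else (0 :: 'v)"
    have eq: "?e g = ?e g'"
      using sv weight_decomp_ext[OF g(1)] weight_decomp_ext[OF g(2)] by blast
    show "g = g'"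
    proof
      fix wt
      show "g wt = g' wt"
      proof (cases "wt \<in> dual_space Vir_cartan")
        case True
        thus ?thesis
          using fun_cong[OF eq, of "ext_weight wt"] by (simp add: ext_weight_dual res_ext_weight)
      next
        case False
        thus ?thesis using g by (simp add: weight_decomp_def)
      qed
    qed
  qed
  moreover have "lie_module Vir scale act"
    using lie_module by (simp add: lie_module_def)
  moreover have "\<exists>F. finite F \<and> weight_space Vir_cartan scale act wt = span F"
    if "wt \<in> dual_space Vir_cartan" for wt
    using weight_space_span[OF ext_weight_dual(1)[OF that]] weight_space_ext[OF that] by metis
  ultimately show ?thesis unfolding weight_module_def weight_decomp_def by blast
qed

text \<open>The same form serves: \<open>\<theta> x\<close> and its projection to \<open>Vir\<close>
  differ by an element of the ideal, hence act alike.\<close>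

lemma unitary_weight_module_Vir: "unitary_weight_module Vir Vir_cartan scale act"
proof -
  have "unitary_module Vir (\<lambda>x. Vir_proj (\<theta> x)) scale act"
    unfolding unitary_module_def
    using weight_module_Vir form adjoint by (auto simp: weight_module_def act_Vir_proj)
  thus ?thesis
    unfolding unitary_weight_module_def using weight_module_Vir conj_anti_involution_Vir by blast
qed

end

theorem proposition3p4:
  fixes scale :: "complex \<Rightarrow> 'v::ab_group_add \<Rightarrow> 'v"
    and act :: "sv \<Rightarrow> 'v \<Rightarrow> 'v"
  assumes "unitary_weight_module UNIV sv_cartan scale act"
  shows "(\<forall>x\<in>sv_M. \<forall>v. act x v = 0) \<and>
         (\<forall>x\<in>sv_Y. \<forall>v. act x v = 0) \<and>
         unitary_weight_module Vir Vir_cartan scale act"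
proof -
  obtain \<theta> B where "conj_anti_involution UNIV \<theta>" "pos_def_hermitian_form scale B"
    "\<And>x u v. B (act x u) v = B u (act (\<theta> x) v)" "weight_module UNIV sv_cartan scale act"
    using assms unfolding unitary_weight_module_def unitary_module_def by auto
  then interpret unitary_sv_module \<theta> scale act B
    by unfold_locales
  have "act x v = 0" if "x \<in> sv_M \<union> sv_Y" for x v
    using that by (intro MY_eq_0) (auto simp: sv_M_eq sv_Y_eq sv_supp_def)
  thus ?thesis using unitary_weight_module_Vir by blast
qed

end
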